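(* Let $m\in\mathbb Z_{\ge0}$ and let $V$ be the irreducible representation of $U_q(sl_2)$ with highest weight $2m$. Let $u_V(\lambda,\mu)=\delta_{V^*}(-\lambda-\rho)\,\delta_V(-\mu-\rho)\,\delta_q(\lambda)\,\Psi_V(q^{-1},-\lambda,-\mu-\rho)$, regarded as a scalar function. Then $$u_V(\lambda,\mu)=q^{-\lambda\mu}\sum_{l=0}^mq^{-l(l-1)/2}(q-q^{-1})^l\frac{[m+l]_q!}{[l]_q!\,[m-l]_q!}\,q^{-l(\lambda+\mu)}\prod_{j=l+1}^{m}(q^{\lambda+j}-q^{-\lambda-j})(q^{\mu+j}-q^{-\mu-j}).$$
   Context: $q=e^t$, $t\in\mathbb C$ not purely imaginary, $q^a:=e^{ta}$; $[a]_q=\frac{q^a-q^{-a}}{q-q^{-1}}$, $[n]_q!=[1]_q\cdots[n]_q$. $U_q(sl_2)$ is generated by $E,F,q^h$ with $q^hEq^{-h}=q^2E$, $q^hFq^{-h}=q^{-2}F$, $EF-FE=\frac{q^h-q^{-h}}{q-q^{-1}}$, $\Delta(E)=E\otimes q^h+1\otimes E$, $\Delta(F)=F\otimes1+q^{-h}\otimes F$, $\Delta(q^h)=q^h\otimes q^h$. Weights are identified with complex numbers: $v$ has weight $\mu$ if $q^hv=q^\mu v$; then $(\mu,\mu')=\mu\mu'/2$, the positive root is $\alpha=2$, and $\rho=1$. $M_\mu$ is the Verma module with highest weight $\mu$ and highest weight vector $v_\mu$. The space $V[0]$ is one dimensional; for $w_0\in V[0]$ nonzero and generic $\mu$, $\Phi_\mu:M_\mu\to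 M_\mu\otimes V$ is the unique intertwiner with $\Phi_\mu v_\mu=v_\mu\otimes w_0+$ terms of lower weight in the first factor. The scalar function $\Psi_V(\lambda,\mu)=\Psi_V(q,\lambda,\mu)$ is defined by $\mathrm{Tr}|_{M_\mu}(\Phi_\mu q^{2\lambda})=\Psi_V(q,\lambda,\mu)\,w_0$, where $q^{2\lambda}$ acts on a vector of weight $\nu$ by $q^{2(\lambda,\nu)}=q^{\lambda\nu}$ (the series converges in a suitable region and is continued to $q^{\lambda\mu}$ times a rational function of $q^{2\lambda},q^{2\mu}$). $\Psi_V(q^{-1},\lambda,\mu)$ is the same function with $q$ replaced by $q^{-1}$. Further, $\delta_q(\lambda)=q^{\lambda}-q^{-\lambda}$, and $\delta_V(\mu)=\delta_{V^*}(\mu)=\prod_{n=1}^{m}(q^{\mu+1-n}-q^{-(\mu+1)+n})$. *)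

theory Defs
  imports Complex_Main "HOL-Library.Poly_Mapping" "HOL-Computational_Algebra.Polynomial"
begin

text \<open>
  The parameter is \<open>q = exp t\<close>. Powers \<open>q\<^sup>a = exp (t a)\<close> depend on \<open>t\<close> and not only on \<open>q\<close>,
  so everything below is parametrised by \<open>t\<close>; replacing \<open>q\<close> by its inverse means replacing
  \<open>t\<close> by \<open>- t\<close>.
\<close>

definition qpow :: "complex \<Rightarrow> complex \<Rightarrow> complex" where
  "qpow t a = exp (t * a)"

definition qnum :: "complex \<Rightarrow> complex \<Rightarrow> complex" where
  "qnum t a = (qpow t a - qpow t (- a)) / (qpow t 1 - qpow t (- 1))"

definition qfact :: "complex \<Rightarrow> nat \<Rightarrow> complex" where
  "qfact t n = (\<Prod>k=1..n. qnum t (of_nat k))"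


section \<open>Complex vector spaces with a chosen basis\<close>

text \<open>
  A complex vector space with basis indexed by the type \<open>'b\<close> is the space of finitely supported
  functions \<open>'b \<Rightarrow>\<^sub>0 complex\<close>; the basis vector with index \<open>b\<close> is \<open>single b 1\<close>. The tensor
  product of the spaces with bases \<open>'a\<close> and \<open>'b\<close> is the space with basis \<open>'a \<times> 'b\<close>.
\<close>

abbreviation single :: "'b \<Rightarrow> complex \<Rightarrow> ('b \<Rightarrow>\<^sub>0 complex)" where
  "single \<equiv> Poly_Mapping.single"

abbreviation lookup :: "('b \<Rightarrow>\<^sub>0 complex) \<Rightarrow> 'b \<Rightarrow> complex" where
  "lookup \<equiv> Poly_Mapping.lookup"

definition cscale :: "complex \<Rightarrow> ('b \<Rightarrow>\<^sub>0 complex) \<Rightarrow> ('b \<Rightarrow>\<^sub>0 complex)" where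
  "cscale c x = Poly_Mapping.map (\<lambda>z. c * z) x"

lemma lookup_cscale [simp]: "lookup (cscale c x) b = c * lookup x b"
  unfolding cscale_def by (simp add: Poly_Mapping.map.rep_eq when_def)

interpretation cvec: vector_space "cscale :: complex \<Rightarrow> ('b \<Rightarrow>\<^sub>0 complex) \<Rightarrow> ('b \<Rightarrow>\<^sub>0 complex)"
  by unfold_locales (auto intro!: poly_mapping_eqI simp: lookup_add algebra_simps)

interpretation cvec_pair: vector_space_pair
    "cscale :: complex \<Rightarrow> ('a \<Rightarrow>\<^sub>0 complex) \<Rightarrow> ('a \<Rightarrow>\<^sub>0 complex)"
    "cscale :: complex \<Rightarrow> ('b \<Rightarrow>\<^sub>0 complex) \<Rightarrow> ('b \<Rightarrow>\<^sub>0 complex)"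
  by unfold_locales

abbreviation clinear :: "(('a \<Rightarrow>\<^sub>0 complex) \<Rightarrow> ('b \<Rightarrow>\<^sub>0 complex)) \<Rightarrow> bool" where
  "clinear \<equiv> Vector_Spaces.linear cscale cscale"

text \<open>The linear map with prescribed values on the basis.\<close>

definition lin_ext :: "('a \<Rightarrow> ('b \<Rightarrow>\<^sub>0 complex)) \<Rightarrow> ('a \<Rightarrow>\<^sub>0 complex) \<Rightarrow> ('b \<Rightarrow>\<^sub>0 complex)" where
  "lin_ext f x = (\<Sum>a\<in>Poly_Mapping.keys x. cscale (lookup x a) (f a))"

lemma lin_ext_sum:
  assumes "finite A" "Poly_Mapping.keys x \<subseteq> A"
  shows "lin_ext f x = (\<Sum>a\<in>A. cscale (lookup x a) (f a))"
  unfolding lin_ext_def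
  by (rule sum.mono_neutral_left) (use assms in \<open>auto simp: in_keys_iff\<close>)

lemma clinear_lin_ext: "clinear (lin_ext f)"
proof (unfold_locales, goal_cases)
  case (1 x y)
  let ?A = "Poly_Mapping.keys x \<union> Poly_Mapping.keys y"
  have "Poly_Mapping.keys (x + y) \<subseteq> ?A" by (rule Poly_Mapping.keys_add)
  then have "lin_ext f (x + y) = (\<Sum>a\<in>?A. cscale (lookup (x + y) a) (f a))"
    by (intro lin_ext_sum) auto
  also have "\<dots> = lin_ext f x + lin_ext f y"
    by (simp add: lin_ext_sum[where A = ?A] lookup_add cvec.scale_left_distrib sum.distrib)
  finally show ?case .
next
  case (2 c x)
  have "Poly_Mapping.keys (cscale c x) \<subseteq> Poly_Mapping.keys x" by (auto simp: in_keys_iff)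
  then have "lin_ext f (cscale c x) =
      (\<Sum>a\<in>Poly_Mapping.keys x. cscale (lookup (cscale c x) a) (f a))"
    by (intro lin_ext_sum) auto
  also have "\<dots> = cscale c (lin_ext f x)"
    by (simp add: lin_ext_def cvec.scale_sum_right)
  finally show ?case .
qed

lemma lin_ext_single [simp]: "lin_ext f (single a c) = cscale c (f a)"
  by (simp add: lin_ext_sum[where A = "{a}"])

lemma cscale_single [simp]: "cscale c (single a d) = single a (c * d)"
  by (rule poly_mapping_eqI) (simp add: lookup_single when_def)

lemma vec_eq_lin_ext: "x = lin_ext (\<lambda>a. single a 1) x"
  by (rule poly_mapping_eqI) (simp add: lin_ext_def lookup_sum lookup_single when_def in_keys_iff)

lemma clinear_eqI:
  assumes f: "clinear f" and g: "clinear g" and eq: "\<And>a. f (single a 1) = g (single a 1)"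
  shows "f x = g x"
proof -
  have *: "h x = (\<Sum>a\<in>Poly_Mapping.keys x. cscale (lookup x a) (h (single a 1)))"
    if h: "clinear h" for h :: "('a \<Rightarrow>\<^sub>0 complex) \<Rightarrow> ('b \<Rightarrow>\<^sub>0 complex)"
  proof -
    interpret h: Vector_Spaces.linear cscale cscale h by (rule h)
    have "h x = h (lin_ext (\<lambda>a. single a 1) x)" using vec_eq_lin_ext by metis
    then show ?thesis unfolding lin_ext_def by (simp add: h.sum flip: h.scale)
  qed
  show ?thesis using *[OF f] *[OF g] eq by simp
qed

definition tensor_vec ::
  "('a \<Rightarrow>\<^sub>0 complex) \<Rightarrow> ('b \<Rightarrow>\<^sub>0 complex) \<Rightarrow> ('a \<times> 'b \<Rightarrow>\<^sub>0 complex)" where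
  "tensor_vec x y =
    (\<Sum>a\<in>Poly_Mapping.keys x. \<Sum>b\<in>Poly_Mapping.keys y. single (a, b) (lookup x a * lookup y b))"

definition tensor_op ::
  "(('a \<Rightarrow>\<^sub>0 complex) \<Rightarrow> ('c \<Rightarrow>\<^sub>0 complex)) \<Rightarrow> (('b \<Rightarrow>\<^sub>0 complex) \<Rightarrow> ('d \<Rightarrow>\<^sub>0 complex))
    \<Rightarrow> ('a \<times> 'b \<Rightarrow>\<^sub>0 complex) \<Rightarrow> ('c \<times> 'd \<Rightarrow>\<^sub>0 complex)" where
  "tensor_op A B = lin_ext (\<lambda>(a, b). tensor_vec (A (single a 1)) (B (single b 1)))"


section \<open>Representations of \<open>U\<^sub>q(sl\<^sub>2)\<close>\<close>

text \<open>
  A representation is given by the operators of the generators; \<open>opK\<close> is the action of \<open>q\<^sup>h\<close> and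
  \<open>opKi\<close> that of its inverse.
\<close>

record 'b uq_rep =
  opE :: "('b \<Rightarrow>\<^sub>0 complex) \<Rightarrow> ('b \<Rightarrow>\<^sub>0 complex)"
  opF :: "('b \<Rightarrow>\<^sub>0 complex) \<Rightarrow> ('b \<Rightarrow>\<^sub>0 complex)"
  opK :: "('b \<Rightarrow>\<^sub>0 complex) \<Rightarrow> ('b \<Rightarrow>\<^sub>0 complex)"
  opKi :: "('b \<Rightarrow>\<^sub>0 complex) \<Rightarrow> ('b \<Rightarrow>\<^sub>0 complex)"

definition is_uq_rep :: "complex \<Rightarrow> 'b uq_rep \<Rightarrow> bool" where
  "is_uq_rep t R \<longleftrightarrow>
     clinear (opE R) \<and> clinear (opF R) \<and> clinear (opK R) \<and> clinear (opKi R) \<and>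
     (\<forall>x. opK R (opKi R x) = x \<and> opKi R (opK R x) = x \<and>
          opK R (opE R (opKi R x)) = cscale (qpow t 2) (opE R x) \<and>
          opK R (opF R (opKi R x)) = cscale (qpow t (- 2)) (opF R x) \<and>
          opE R (opF R x) - opF R (opE R x) =
            cscale (1 / (qpow t 1 - qpow t (- 1))) (opK R x - opKi R x))"

definition weight_space :: "complex \<Rightarrow> 'b uq_rep \<Rightarrow> complex \<Rightarrow> ('b \<Rightarrow>\<^sub>0 complex) set" where
  "weight_space t R \<nu> = {x. opK R x = cscale (qpow t \<nu>) x}"

definition is_subrep :: "'b uq_rep \<Rightarrow> ('b \<Rightarrow>\<^sub>0 complex) set \<Rightarrow> bool" where
  "is_subrep R S \<longleftrightarrow> cvec.subspace S \<and>
     (\<forall>x\<in>S. opE R x \<in> S \<and> opF R x \<in> S \<and> opK R x \<in> S \<and> opKi R x \<in> S)"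

definition irreducible_rep :: "complex \<Rightarrow> 'b uq_rep \<Rightarrow> bool" where
  "irreducible_rep t R \<longleftrightarrow> is_uq_rep t R \<and> (\<exists>x :: 'b \<Rightarrow>\<^sub>0 complex. x \<noteq> 0) \<and>
     (\<forall>S. is_subrep R S \<longrightarrow> S = {0} \<or> S = UNIV)"

definition has_highest_weight :: "complex \<Rightarrow> 'b uq_rep \<Rightarrow> complex \<Rightarrow> bool" where
  "has_highest_weight t R \<nu> \<longleftrightarrow> (\<exists>x. x \<noteq> 0 \<and> opE R x = 0 \<and> x \<in> weight_space t R \<nu>)"

text \<open>
  The tensor product, with the coproduct \<open>\<Delta>(E) = E \<otimes> q\<^sup>h + 1 \<otimes> E\<close>, \<open>\<Delta>(F) = F \<otimes> 1 + q\<^sup>-\<^sup>h \<otimes> F\<close>,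
  \<open>\<Delta>(q\<^sup>h) = q\<^sup>h \<otimes> q\<^sup>h\<close>.
\<close>

definition tensor_rep :: "'a uq_rep \<Rightarrow> 'b uq_rep \<Rightarrow> ('a \<times> 'b) uq_rep" where
  "tensor_rep R S = \<lparr>
     opE = (\<lambda>z. tensor_op (opE R) (opK S) z + tensor_op id (opE S) z),
     opF = (\<lambda>z. tensor_op (opF R) id z + tensor_op (opKi R) (opF S) z),
     opK = tensor_op (opK R) (opK S),
     opKi = tensor_op (opKi R) (opKi S) \<rparr>"

definition intertwiner ::
  "'a uq_rep \<Rightarrow> 'b uq_rep \<Rightarrow> (('a \<Rightarrow>\<^sub>0 complex) \<Rightarrow> ('b \<Rightarrow>\<^sub>0 complex)) \<Rightarrow> bool" where
  "intertwiner R S f \<longleftrightarrow> clinear f \<and>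
     (\<forall>x. f (opE R x) = opE S (f x) \<and> f (opF R x) = opF S (f x) \<and>
          f (opK R x) = opK S (f x) \<and> f (opKi R x) = opKi S (f x))"


section \<open>Verma modules\<close>

text \<open>
  The Verma module \<open>M\<^sub>\<mu>\<close> in the basis \<open>F\<^sup>n v\<^sub>\<mu>\<close>, indexed by \<open>n\<close>; the highest weight vector \<open>v\<^sub>\<mu>\<close>
  is \<open>single 0 1\<close>, and the basis vector with index \<open>n\<close> has weight \<open>\<mu> - 2 n\<close>. For \<open>n = 0\<close> the
  coefficient \<open>qnum t 0\<close> in \<open>opE\<close> vanishes.
\<close>

definition verma :: "complex \<Rightarrow> complex \<Rightarrow> nat uq_rep" where
  "verma t \<mu> = \<lparr>
     opE = lin_ext (\<lambda>n. single (n - 1) (qnum t (of_nat n) * qnum t (\<mu> - of_nat n + 1))),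
     opF = lin_ext (\<lambda>n. single (Suc n) 1),
     opK = lin_ext (\<lambda>n. single n (qpow t (\<mu> - 2 * of_nat n))),
     opKi = lin_ext (\<lambda>n. single n (qpow t (- (\<mu> - 2 * of_nat n)))) \<rparr>"

lemma qpow_add: "qpow t (a + b) = qpow t a * qpow t b"
  by (simp add: qpow_def distrib_left exp_add)

lemma qpow_0 [simp]: "qpow t 0 = 1"
  by (simp add: qpow_def)

lemma qpow_nz [simp]: "qpow t a \<noteq> 0"
  by (simp add: qpow_def)

lemma qpow_minus: "qpow t (- a) = inverse (qpow t a)"
  by (simp add: qpow_def exp_minus)

lemma qpow_diff: "qpow t (a - b) = qpow t a / qpow t b"
  by (simp add: qpow_def right_diff_distrib exp_diff)

lemma q_minus_q_inverse_nz:
  assumes "Re t \<noteq> 0" shows "qpow t 1 - qpow t (- 1) \<noteq> 0"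
proof
  assume "qpow t 1 - qpow t (- 1) = 0"
  then have "cmod (qpow t 1) = cmod (qpow t (- 1))" by simp
  then show False using assms by (simp add: qpow_def)
qed

lemma qnum_step:
  assumes "Re t \<noteq> 0"
  shows "qnum t (a + 1) * qnum t (\<mu> - a) - qnum t a * qnum t (\<mu> - a + 1) = qnum t (\<mu> - 2 * a)"
proof -
  have nz: "qpow t 1 - inverse (qpow t 1) \<noteq> 0"
    using q_minus_q_inverse_nz[OF assms] by (simp add: qpow_minus)
  have two: "qpow t (2 * a) = qpow t a * qpow t a" using qpow_add[of t a a] by (simp only: mult_2)
  define q A M where "q = qpow t 1" and "A = qpow t a" and "M = qpow t \<mu>"
  have [simp]: "q \<noteq> 0" "A \<noteq> 0" "M \<noteq> 0" by (auto simp: q_def A_def M_def)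
  have d: "q - 1 / q \<noteq> 0" using nz by (simp add: q_def inverse_eq_divide)
  have "(A * q - 1 / (A * q)) * (M / A - A / M) - (A - 1 / A) * (M * q / A - A / (M * q))
        = (q - 1 / q) * (M / (A * A) - A * A / M)"
    by (simp add: field_simps)
  moreover have "qnum t (a + 1) = (A * q - 1 / (A * q)) / (q - 1 / q)"
    "qnum t (\<mu> - a) = (M / A - A / M) / (q - 1 / q)"
    "qnum t a = (A - 1 / A) / (q - 1 / q)"
    "qnum t (\<mu> - a + 1) = (M * q / A - A / (M * q)) / (q - 1 / q)"
    "qnum t (\<mu> - 2 * a) = (M / (A * A) - A * A / M) / (q - 1 / q)"
    unfolding qnum_def qpow_minus
    by (simp_all only: qpow_add qpow_diff two q_def A_def M_def inverse_eq_divide, simp_all)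
  moreover have "U / e * (W / e) - Y / e * (Z / e) = X / e"
    if "U * W - Y * Z = e * X" "e \<noteq> 0" for U W Y Z X e :: complex
  proof -
    have "U / e * (W / e) - Y / e * (Z / e) = (U * W - Y * Z) / (e * e)"
      by (simp add: diff_divide_distrib)
    then show ?thesis using that by simp
  qed
  ultimately show ?thesis using d by simp
qed

text \<open>
  \<open>verma t \<mu>\<close> satisfies the defining relations and has the universal property of the Verma module.
\<close>

lemma clinear_compose: "clinear f \<Longrightarrow> clinear g \<Longrightarrow> clinear (\<lambda>x. g (f x))"
  using Vector_Spaces.linear_compose[of cscale cscale f cscale g] by (simp add: o_def)

lemma clinear_cscale: "clinear f \<Longrightarrow> clinear (\<lambda>x. cscale c (f x))"
  by (rule cvec_pair.linear_compose_scale_right)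

lemma clinear_minus: "clinear f \<Longrightarrow> clinear g \<Longrightarrow> clinear (\<lambda>x. f x - g x)"
  by (rule cvec_pair.linear_compose_sub)

lemma verma_single [simp]:
  "opE (verma t \<mu>) (single n c) =
     single (n - 1) (c * (qnum t (of_nat n) * qnum t (\<mu> - of_nat n + 1)))"
  "opF (verma t \<mu>) (single n c) = single (Suc n) c"
  "opK (verma t \<mu>) (single n c) = single n (c * qpow t (\<mu> - 2 * of_nat n))"
  "opKi (verma t \<mu>) (single n c) = single n (c * qpow t (- (\<mu> - 2 * of_nat n)))"
  by (simp_all add: verma_def)

lemma clinear_verma:
  "clinear (opE (verma t \<mu>))" "clinear (opF (verma t \<mu>))"
  "clinear (opK (verma t \<mu>))" "clinear (opKi (verma t \<mu>))"
  by (simp_all add: verma_def clinear_lin_ext)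

lemma verma_is_uq_rep:
  assumes "Re t \<noteq> 0" shows "is_uq_rep t (verma t \<mu>)"
proof -
  let ?R = "verma t \<mu>"
  note v = clinear_verma[of t \<mu>]
  note lin = v clinear_cscale clinear_minus clinear_compose[OF v(1) v(2)]
    clinear_compose[OF v(2) v(1)] clinear_compose[OF v(3) v(4)] clinear_compose[OF v(4) v(3)]
    clinear_compose[OF clinear_compose[OF v(4) v(1)] v(3)]
    clinear_compose[OF clinear_compose[OF v(4) v(2)] v(3)]
  have id: "clinear (\<lambda>x. x :: nat \<Rightarrow>\<^sub>0 complex)" using cvec.linear_id by (simp add: id_def)
  have "opK ?R (opKi ?R x) = x" for x
    by (rule clinear_eqI[where f = "\<lambda>x. opK ?R (opKi ?R x)"
        and g = "\<lambda>x. x"])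
        (simp_all add: lin id flip: qpow_add)
  moreover have "opKi ?R (opK ?R x) = x" for x
    by (rule clinear_eqI[where f = "\<lambda>x. opKi ?R (opK ?R x)"
        and g = "\<lambda>x. x"])
        (simp_all add: lin id flip: qpow_add)
  moreover have "opK ?R (opE ?R (opKi ?R x)) = cscale (qpow t 2) (opE ?R x)" for x
  proof (rule clinear_eqI[where f = "\<lambda>x. opK ?R (opE ?R (opKi ?R x))"
        and g = "\<lambda>x. cscale (qpow t 2) (opE ?R x)"], goal_cases)
    case (3 n)
    show ?case
    proof (cases n)
      case (Suc k)
      have "qpow t (- (\<mu> - 2 * of_nat n)) * qpow t (\<mu> - 2 * of_nat k) = qpow t 2"
        by (simp add: Suc algebra_simps flip: qpow_add)
      then show ?thesis by (simp add: Suc ac_simps)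
    qed (simp add: qnum_def verma_def lin_ext_def lookup_single)
  qed (intro lin)+
  moreover have "opK ?R (opF ?R (opKi ?R x)) = cscale (qpow t (- 2)) (opF ?R x)" for x
    by (rule clinear_eqI[where f = "\<lambda>x. opK ?R (opF ?R (opKi ?R x))"
        and g = "\<lambda>x. cscale (qpow t (- 2)) (opF ?R x)"])
        (simp_all add: lin algebra_simps flip: qpow_add)
  moreover have "opE ?R (opF ?R x) - opF ?R (opE ?R x) =
      cscale (1 / (qpow t 1 - qpow t (- 1))) (opK ?R x - opKi ?R x)" for x
  proof (rule clinear_eqI[where f = "\<lambda>x. opE ?R (opF ?R x) - opF ?R (opE ?R x)"
        and g = "\<lambda>x. cscale (1 / (qpow t 1 - qpow t (- 1))) (opK ?R x - opKi ?R x)"], goal_cases)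
    case (3 n)
    have F: "opF ?R (opE ?R (single n 1)) =
        single n (qnum t (of_nat n) * qnum t (\<mu> - of_nat n + 1))"
    proof (cases n)
      case 0
      then show ?thesis by (simp add: qnum_def verma_def lin_ext_def lookup_single)
    qed (simp add: qnum_def)
    have "opE ?R (opF ?R (single n 1)) - opF ?R (opE ?R (single n 1)) =
        single n (qnum t (of_nat n + 1) * qnum t (\<mu> - of_nat n) -
          qnum t (of_nat n) * qnum t (\<mu> - of_nat n + 1))"
      unfolding F by (simp add: single_diff add.commute)
    also have "\<dots> = single n (qnum t (\<mu> - 2 * of_nat n))"
      using qnum_step[OF assms] by simp
    finally show ?case
      by (simp add: qnum_def flip: single_diff)
  qed (intro lin)+
  ultimately show ?thesis
    unfolding is_uq_rep_def using clinear_verma by blast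
qed

theorem verma_universal:
  fixes R :: "'b uq_rep"
  assumes t: "Re t \<noteq> 0" and R: "is_uq_rep t R"
    and w: "opE R w = 0" "w \<in> weight_space t R \<mu>"
  shows "\<exists>!f. intertwiner (verma t \<mu>) R f \<and> f (single 0 1) = w"
proof -
  define u where "u n = (opF R ^^ n) w" for n
  have u0: "u 0 = w" and uS: "opF R (u n) = u (Suc n)" for n by (simp_all add: u_def)
  have lin: "clinear (opE R)" "clinear (opF R)" "clinear (opK R)" "clinear (opKi R)"
    and KKi: "opK R (opKi R x) = x" and KiK: "opKi R (opK R x) = x"
    and KF: "opK R (opF R (opKi R x)) = cscale (qpow t (- 2)) (opF R x)"
    and EF: "opE R (opF R x) - opF R (opE R x) =
      cscale (1 / (qpow t 1 - qpow t (- 1))) (opK R x - opKi R x)" for x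
    using R unfolding is_uq_rep_def by blast+
  interpret E: Vector_Spaces.linear cscale cscale "opE R" by (rule lin)
  interpret F: Vector_Spaces.linear cscale cscale "opF R" by (rule lin)
  interpret K: Vector_Spaces.linear cscale cscale "opK R" by (rule lin)
  interpret Ki: Vector_Spaces.linear cscale cscale "opKi R" by (rule lin)
  have Ku: "opK R (u n) = cscale (qpow t (\<mu> - 2 * of_nat n)) (u n)" for n
  proof (induction n)
    case 0 then show ?case using w by (simp add: u0 weight_space_def)
  next
    case (Suc n)
    have "opK R (opF R (u n)) = opK R (opF R (opKi R (opK R (u n))))" by (simp add: KiK)
    also have "\<dots> = cscale (qpow t (- 2)) (opF R (opK R (u n)))" by (rule KF)
    also have "\<dots> = cscale (qpow t (- 2 + (\<mu> - 2 * of_nat n))) (opF R (u n))"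
      by (simp only: Suc F.scale cvec.scale_scale qpow_add)
    finally show ?case by (simp add: uS algebra_simps)
  qed
  have Kiu: "opKi R (u n) = cscale (qpow t (- (\<mu> - 2 * of_nat n))) (u n)" for n
  proof -
    have "cscale (qpow t (\<mu> - 2 * of_nat n)) (opKi R (u n)) = u n"
      using KiK[of "u n"] by (simp add: Ku Ki.scale)
    then have "cscale (qpow t (- (\<mu> - 2 * of_nat n)) * qpow t (\<mu> - 2 * of_nat n)) (opKi R (u n)) =
        cscale (qpow t (- (\<mu> - 2 * of_nat n))) (u n)"
      by (metis cvec.scale_scale)
    then show ?thesis by (simp flip: qpow_add)
  qed
  have Eu: "opE R (u n) = cscale (qnum t (of_nat n) * qnum t (\<mu> - of_nat n + 1)) (u (n - 1))" for n
  proof (induction n)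
    case 0 then show ?case using w by (simp add: u0 qnum_def)
  next
    case (Suc n)
    have FE: "opF R (opE R (u n)) = cscale (qnum t (of_nat n) * qnum t (\<mu> - of_nat n + 1)) (u n)"
    proof (cases n)
      case 0 then show ?thesis using w by (simp add: u0 qnum_def F.zero)
    next
      case (Suc k)
      have "opF R (opE R (u n)) =
          cscale (qnum t (of_nat n) * qnum t (\<mu> - of_nat n + 1)) (opF R (u (n - 1)))"
        by (simp only: Suc.IH F.scale)
      then show ?thesis by (simp add: Suc uS)
    qed
    have "opE R (u (Suc n)) = opF R (opE R (u n)) +
        cscale (1 / (qpow t 1 - qpow t (- 1))) (opK R (u n) - opKi R (u n))"
      using EF[of "u n"] by (simp add: uS algebra_simps)
    also have "\<dots> = cscale (qnum t (of_nat n) * qnum t (\<mu> - of_nat n + 1) + qnum t (\<mu> - 2 * of_nat n)) (u n)"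
      unfolding FE Ku Kiu
      by (simp add: qnum_def cvec.scale_left_distrib flip: cvec.scale_left_diff_distrib)
    also have "qnum t (of_nat n) * qnum t (\<mu> - of_nat n + 1) + qnum t (\<mu> - 2 * of_nat n) =
        qnum t (of_nat n + 1) * qnum t (\<mu> - of_nat n)"
      using qnum_step[OF t, of "of_nat n" \<mu>] by (simp add: algebra_simps)
    finally show ?case by (simp add: add.commute)
  qed
  show ?thesis
  proof (rule ex1I[of _ "lin_ext u"])
    have cl: "clinear (\<lambda>x. lin_ext u (g x))" if "clinear g"
      for g :: "(nat \<Rightarrow>\<^sub>0 complex) \<Rightarrow> (nat \<Rightarrow>\<^sub>0 complex)"
      by (rule clinear_compose[OF that clinear_lin_ext])
    have cl': "clinear (\<lambda>x. g (lin_ext u x))" if "clinear g"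
      for g :: "('b \<Rightarrow>\<^sub>0 complex) \<Rightarrow> ('b \<Rightarrow>\<^sub>0 complex)"
      by (rule clinear_compose[OF clinear_lin_ext that])
    have copE: "lin_ext u (opE (verma t \<mu>) x) = opE R (lin_ext u x)" for x
      by (rule clinear_eqI[OF cl[OF clinear_verma(1)] cl'[OF lin(1)]])
        (simp only: verma_single lin_ext_single Eu cvec.scale_one mult_1)
    have copF: "lin_ext u (opF (verma t \<mu>) x) = opF R (lin_ext u x)" for x
      by (rule clinear_eqI[OF cl[OF clinear_verma(2)] cl'[OF lin(2)]])
        (simp only: verma_single lin_ext_single uS cvec.scale_one mult_1)
    have copK: "lin_ext u (opK (verma t \<mu>) x) = opK R (lin_ext u x)" for x
      by (rule clinear_eqI[OF cl[OF clinear_verma(3)] cl'[OF lin(3)]])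
        (simp only: verma_single lin_ext_single Ku cvec.scale_one mult_1)
    have copKi: "lin_ext u (opKi (verma t \<mu>) x) = opKi R (lin_ext u x)" for x
      by (rule clinear_eqI[OF cl[OF clinear_verma(4)] cl'[OF lin(4)]])
        (simp only: verma_single lin_ext_single Kiu cvec.scale_one mult_1)
    have "intertwiner (verma t \<mu>) R (lin_ext u)"
      unfolding intertwiner_def by (intro conjI allI clinear_lin_ext copE copF copK copKi)
    moreover have "lin_ext u (single 0 1) = w"
      by (simp only: lin_ext_single u0 cvec.scale_one)
    ultimately show "intertwiner (verma t \<mu>) R (lin_ext u) \<and> lin_ext u (single 0 1) = w" ..
  next
    fix f assume "intertwiner (verma t \<mu>) R f \<and> f (single 0 1) = w"
    then have f: "clinear f" "f (single 0 1) = w"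
      and fF: "f (opF (verma t \<mu>) x) = opF R (f x)" for x
      unfolding intertwiner_def by blast+
    have fu: "f (single n 1) = u n" for n
    proof (induction n)
      case (Suc n)
      have "f (single (Suc n) 1) = f (opF (verma t \<mu>) (single n 1))" by simp
      also have "\<dots> = u (Suc n)" by (simp only: fF Suc uS)
      finally show ?case .
    qed (simp only: f u0)
    have "f x = lin_ext u x" for x
      by (rule clinear_eqI[of f "lin_ext u"])
        (simp_all only: f fu clinear_lin_ext lin_ext_single cvec.scale_one)
    then show "f = lin_ext u" ..
  qed
qed

text \<open>
  \<open>generic t \<mu>\<close> says that no \<open>F\<^sup>n v\<^sub>\<mu>\<close> with \<open>n > 0\<close> is singular, i.e. that \<open>M\<^sub>\<mu>\<close> is irreducible.
\<close>

definition generic :: "complex \<Rightarrow> complex \<Rightarrow> bool" where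
  "generic t \<mu> \<longleftrightarrow> (\<forall>n::nat. qnum t (\<mu> - of_nat n) \<noteq> 0)"


section \<open>Intertwiners and their traces\<close>

definition is_Phi :: "complex \<Rightarrow> complex \<Rightarrow> 'b uq_rep \<Rightarrow> ('b \<Rightarrow>\<^sub>0 complex)
    \<Rightarrow> ((nat \<Rightarrow>\<^sub>0 complex) \<Rightarrow> (nat \<times> 'b \<Rightarrow>\<^sub>0 complex)) \<Rightarrow> bool" where
  "is_Phi t \<mu> V w0 \<Phi> \<longleftrightarrow> intertwiner (verma t \<mu>) (tensor_rep (verma t \<mu>) V) \<Phi> \<and>
     (\<forall>(n, b) \<in> Poly_Mapping.keys (\<Phi> (single 0 1) - tensor_vec (single 0 1) w0). n > 0)"

definition Phi :: "complex \<Rightarrow> complex \<Rightarrow> 'b uq_rep \<Rightarrow> ('b \<Rightarrow>\<^sub>0 complex)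
    \<Rightarrow> (nat \<Rightarrow>\<^sub>0 complex) \<Rightarrow> (nat \<times> 'b \<Rightarrow>\<^sub>0 complex)" where
  "Phi t \<mu> V w0 = (THE \<Phi>. is_Phi t \<mu> V w0 \<Phi>)"

text \<open>
  \<open>has_trace t lam \<mu> A x\<close>: the trace over \<open>M\<^sub>\<mu>\<close> of \<open>A q\<^sup>2\<^sup>\<lambda>\<close>, for \<open>A : M\<^sub>\<mu> \<rightarrow> M\<^sub>\<mu> \<otimes> V\<close>, converges
  to the vector \<open>x\<close> of \<open>V\<close>; the convergence is coordinatewise in \<open>V\<close>.
\<close>

definition has_trace :: "complex \<Rightarrow> complex \<Rightarrow> complex
    \<Rightarrow> ((nat \<Rightarrow>\<^sub>0 complex) \<Rightarrow> (nat \<times> 'b \<Rightarrow>\<^sub>0 complex)) \<Rightarrow> ('b \<Rightarrow>\<^sub>0 complex) \<Rightarrow> bool" where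
  "has_trace t lam \<mu> A x \<longleftrightarrow>
     (\<forall>b. (\<lambda>n. qpow t (lam * (\<mu> - 2 * of_nat n)) * lookup (A (single n 1)) (n, b)) sums lookup x b)"

definition poly2 :: "complex poly poly \<Rightarrow> complex \<Rightarrow> complex \<Rightarrow> complex" where
  "poly2 P x y = poly (poly P [:x:]) y"

text \<open>
  The fraction \<open>P / Q\<close> represents the rational function \<open>r\<close> such that \<open>q\<^sup>\<lambda>\<^sup>\<mu> r(q\<^sup>2\<^sup>\<lambda>, q\<^sup>2\<^sup>\<mu>)\<close>
  continues the trace. The trace is a series in \<open>q\<^sup>-\<^sup>2\<^sup>\<lambda>\<close>, so the region of convergence is
  a neighbourhood of infinity in \<open>q\<^sup>2\<^sup>\<lambda>\<close>.
\<close>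

definition continues_trace :: "complex \<Rightarrow> 'b uq_rep \<Rightarrow> ('b \<Rightarrow>\<^sub>0 complex)
    \<Rightarrow> complex poly poly \<Rightarrow> complex poly poly \<Rightarrow> bool" where
  "continues_trace t V w0 P Q \<longleftrightarrow> Q \<noteq> 0 \<and>
     (\<exists>B. \<forall>lam \<mu>. generic t \<mu> \<and> cmod (qpow t (2 * lam)) > B \<and>
        poly2 Q (qpow t (2 * lam)) (qpow t (2 * \<mu>)) \<noteq> 0 \<longrightarrow>
        has_trace t lam \<mu> (Phi t \<mu> V w0)
          (cscale (qpow t (lam * \<mu>) *
             (poly2 P (qpow t (2 * lam)) (qpow t (2 * \<mu>)) / poly2 Q (qpow t (2 * lam)) (qpow t (2 * \<mu>))))
           w0))"

definition Psi_regular :: "complex \<Rightarrow> 'b uq_rep \<Rightarrow> ('b \<Rightarrow>\<^sub>0 complex) \<Rightarrow> complex \<Rightarrow> complex \<Rightarrow> bool" where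
  "Psi_regular t V w0 lam \<mu> \<longleftrightarrow>
     (\<exists>P Q. continues_trace t V w0 P Q \<and> poly2 Q (qpow t (2 * lam)) (qpow t (2 * \<mu>)) \<noteq> 0)"

text \<open>The value of \<open>\<Psi>\<^sub>V\<close> is meaningful only at points where \<open>Psi_regular\<close> holds.\<close>

definition Psi :: "complex \<Rightarrow> 'b uq_rep \<Rightarrow> ('b \<Rightarrow>\<^sub>0 complex) \<Rightarrow> complex \<Rightarrow> complex \<Rightarrow> complex" where
  "Psi t V w0 lam \<mu> = (THE z. \<exists>P Q. continues_trace t V w0 P Q \<and>
     poly2 Q (qpow t (2 * lam)) (qpow t (2 * \<mu>)) \<noteq> 0 \<and>
     z = qpow t (lam * \<mu>) *
       (poly2 P (qpow t (2 * lam)) (qpow t (2 * \<mu>)) / poly2 Q (qpow t (2 * lam)) (qpow t (2 * \<mu>))))"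

definition delta_q :: "complex \<Rightarrow> complex \<Rightarrow> complex" where
  "delta_q t lam = qpow t lam - qpow t (- lam)"

text \<open>Since \<open>V\<close> and its dual are isomorphic, this is both \<open>\<delta>\<^sub>V\<close> and the one of the dual.\<close>

definition delta_V :: "complex \<Rightarrow> nat \<Rightarrow> complex \<Rightarrow> complex" where
  "delta_V t m \<mu> = (\<Prod>n=1..m. qpow t (\<mu> + 1 - of_nat n) - qpow t (- (\<mu> + 1) + of_nat n))"

text \<open>
  In \<open>u\<^sub>V\<close> the trace function is taken at the inverse of \<open>q\<close>, where the representation \<open>V\<close> and
  the vector \<open>w\<^sub>0\<close> are those of the quantum group at that parameter. Hence \<open>V\<close> and \<open>w0\<close> are
  families indexed by the parameter. Here \<open>\<rho> = 1\<close>.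
\<close>

definition u_V :: "complex \<Rightarrow> nat \<Rightarrow> (complex \<Rightarrow> 'b uq_rep) \<Rightarrow> (complex \<Rightarrow> ('b \<Rightarrow>\<^sub>0 complex))
    \<Rightarrow> complex \<Rightarrow> complex \<Rightarrow> complex" where
  "u_V t m V w0 lam \<mu> = delta_V t m (- lam - 1) * delta_V t m (- \<mu> - 1) * delta_q t lam *
     Psi (- t) (V (- t)) (w0 (- t)) (- lam) (- \<mu> - 1)"

end

theory Submission
  imports Defs
begin

text \<open>
  The trace function can be computed in closed form, because the intertwiner is explicit. An intertwiner
  out of \<open>M\<^sub>\<mu>\<close> is the same as a singular vector of weight \<open>\<mu>\<close> in \<open>M\<^sub>\<mu> \<otimes> V\<close>. Writing such a vector as
  \<open>\<Sum>k. F\<^sup>k v\<^sub>\<mu> \<otimes> x\<^sub>k\<close>, being annihilated by \<open>\<Delta>(E)\<close> means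
  \<open>[k + 1] [\<mu> - k] q\<^sup>h x\<^sub>k\<^sub>+\<^sub>1 = - E x\<^sub>k\<close>; for generic \<open>\<mu>\<close> it has exactly one solution with \<open>x\<^sub>0 = w\<^sub>0\<close>,
  and \<open>x\<^sub>k\<close> is a multiple of \<open>E\<^sup>k w\<^sub>0\<close> (\<open>is_Phi_iff\<close>). The image of \<open>F\<^sup>n v\<^sub>\<mu>\<close> is obtained by applying
  \<open>\<Delta>(F)\<^sup>n\<close>, and as the two summands of \<open>\<Delta>(F)\<close> commute up to \<open>q\<^sup>2\<close>, the \<open>q\<close>-binomial theorem gives its
  diagonal coefficient (\<open>lookup_F_power\<close>, \<open>lookup_Phi_diagonal\<close>). The only information about \<open>V\<close> that
  enters is \<open>F\<^sup>k E\<^sup>k w\<^sub>0 = [m + k]! / [m - k]! w\<^sub>0\<close> and \<open>E\<^sup>m\<^sup>+\<^sup>1 w\<^sub>0 = 0\<close>. Both follow without a basis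
  of \<open>V\<close>: an irreducible module has no proper nonzero subrepresentation, so the Casimir element acts by
  a scalar and \<open>E\<close> is locally nilpotent (\<open>FE_weight\<close>, \<open>E_power_eq_0\<close>).

  Summing over \<open>n\<close> with the generating functions of the Gaussian binomial coefficients (\<open>qbin_sums\<close>),
  the trace becomes \<open>q\<^sup>\<lambda>\<^sup>\<mu>\<close> times
  \<open>\<Sum>k\<le>m. a\<^sub>k x / (\<Prod>j\<le>k. x - q\<^sup>2\<^sup>j) / (\<Prod>i<k. q\<^sup>-\<^sup>i y - q\<^sup>i)\<close> with \<open>x = q\<^sup>2\<^sup>\<lambda>\<close> and \<open>y = q\<^sup>2\<^sup>\<mu>\<close>
  (\<open>has_trace_Phi\<close>). The common denominator of this sum is, up to a power of \<open>q\<close>, the product of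
  the \<open>\<delta>\<close> factors of \<open>u\<^sub>V\<close> at the substituted arguments. Hence multiplication by these factors leaves
  the numerator, and its summands are those of the asserted formula after the powers of \<open>q\<close> have
  been collected (\<open>summand_exponents\<close>).

  As the continuation is described by arbitrary fractions of polynomials, it also has to be shown that
  two fractions continuing the trace are equal (\<open>continues_trace_unique\<close>). By cross-multiplication the
  formula then holds at every regular point, including those where a \<open>\<delta>\<close> factor vanishes.
\<close>

(* single 0 1 is the highest weight vector here; rewriting it to the unit of the convolution
   product on nat would hide it. *)
declare Poly_Mapping.single_one [simp del]

section \<open>Powers of \<open>q\<close> and \<open>q\<close>-numbers\<close>

lemma qpow_of_nat_mult: "qpow t (of_nat n * a) = qpow t a ^ n"
  by (simp add: qpow_def exp_of_nat_mult [symmetric] mult.left_commute)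

lemma qpow_as_power:
  "qpow t 2 = qpow t 1 ^ 2" "qpow t (- 2) = 1 / qpow t 1 ^ 2" "qpow t (- 1) = 1 / qpow t 1"
  using qpow_of_nat_mult [of t 2 1] by (simp_all add: qpow_minus inverse_eq_divide)

lemma qpow_uminus_left: "qpow (- t) a = qpow t (- a)"
  by (simp add: qpow_def)

lemma qnum_uminus_left: "qnum (- t) a = qnum t a"
  using minus_divide_divide [of "qpow t a - qpow t (- a)" "qpow t 1 - qpow t (- 1)"]
  by (simp add: qnum_def qpow_uminus_left)

text \<open>
  Since \<open>t\<close> is not purely imaginary, the modulus of \<open>q\<close> differs from \<open>1\<close>, so \<open>q\<close> is not a root
  of unity and no \<open>q\<close>-number of a nonzero integer vanishes.
\<close>

lemma qpow_of_real_eq_iff: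
  assumes "Re t \<noteq> 0"
  shows "qpow t (of_real x) = qpow t (of_real y) \<longleftrightarrow> x = y"
proof
  assume "qpow t (of_real x) = qpow t (of_real y)"
  then have "cmod (qpow t (of_real x)) = cmod (qpow t (of_real y))" by simp
  then show "x = y" using assms by (simp add: qpow_def)
qed simp

lemma qnum_of_real_nz:
  assumes "Re t \<noteq> 0" "x \<noteq> 0"
  shows "qnum t (of_real x) \<noteq> 0"
  using qpow_of_real_eq_iff [OF assms(1), of x "- x"] q_minus_q_inverse_nz [OF assms(1)] assms(2)
  by (simp add: qnum_def)

lemma qnum_of_int_nz:
  assumes "Re t \<noteq> 0" "k \<noteq> 0"
  shows "qnum t (of_int k) \<noteq> 0"
  using qnum_of_real_nz [of t "of_int k"] assms by simp

lemma qnum_of_nat_nz: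
  assumes "Re t \<noteq> 0" "k \<noteq> 0"
  shows "qnum t (of_nat k) \<noteq> 0"
  using qnum_of_int_nz [of t "int k"] assms by simp

lemma qfact_nz:
  assumes "Re t \<noteq> 0"
  shows "qfact t n \<noteq> 0"
  using qnum_of_nat_nz [OF assms] by (simp add: qfact_def)

lemma qfact_Suc: "qfact t (Suc n) = qnum t (of_nat (Suc n)) * qfact t n"
  by (simp add: qfact_def prod.nat_ivl_Suc' mult.commute)

lemma qnum_0 [simp]: "qnum t 0 = 0"
  by (simp add: qnum_def)

lemma qnum_mult:
  "qnum t a * qnum t b =
     (qpow t (a + b) + qpow t (- (a + b)) - qpow t (a - b) - qpow t (b - a)) /
     (qpow t 1 - qpow t (- 1)) ^ 2"
  by (simp add: qnum_def power2_eq_square algebra_simps flip: qpow_add)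

section \<open>Linear maps and tensor products\<close>

lemma clinearI:
  "(\<And>x y. f (x + y) = f x + f y) \<Longrightarrow> (\<And>c x. f (cscale c x) = cscale c (f x)) \<Longrightarrow> clinear f"
  by unfold_locales auto

lemma clinear_rules:
  assumes "clinear f"
  shows "f (x + y) = f x + f y" "f (x - y) = f x - f y" "f (cscale c x) = cscale c (f x)"
    "f 0 = 0" "f (- x) = - f x" "f (sum g A) = (\<Sum>a\<in>A. f (g a))"
proof -
  interpret f: Vector_Spaces.linear cscale cscale f by (rule assms)
  show "f (x + y) = f x + f y" "f (x - y) = f x - f y" "f (cscale c x) = cscale c (f x)"
    "f 0 = 0" "f (- x) = - f x" "f (sum g A) = (\<Sum>a\<in>A. f (g a))"
    by (simp_all add: f.add f.diff f.scale f.zero f.neg f.sum)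
qed

lemma clinear_ident: "clinear (\<lambda>x. x)"
  by (rule clinearI) auto

lemma clinear_id: "clinear id"
  by (rule clinearI) auto

lemma clinear_add: "clinear f \<Longrightarrow> clinear g \<Longrightarrow> clinear (\<lambda>x. f x + g x)"
  by (rule cvec_pair.linear_compose_add)

lemma clinear_funpow:
  fixes f :: "('b \<Rightarrow>\<^sub>0 complex) \<Rightarrow> ('b \<Rightarrow>\<^sub>0 complex)"
  shows "clinear f \<Longrightarrow> clinear (f ^^ n)"
  by (induction n) (simp_all add: o_def clinear_id clinear_ident clinear_compose)

lemma lookup_tensor_vec [simp]: "lookup (tensor_vec x y) (a, b) = lookup x a * lookup y b"
proof -
  have "lookup (tensor_vec x y) (a, b) =
      (\<Sum>a'\<in>Poly_Mapping.keys x. \<Sum>b'\<in>Poly_Mapping.keys y.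
         if a' = a then if b' = b then lookup x a * lookup y b else 0 else 0)"
    unfolding tensor_vec_def
    by (auto simp: lookup_sum lookup_single when_def intro!: sum.cong)
  also have "\<dots> = (\<Sum>a'\<in>Poly_Mapping.keys x. if a' = a then 
         (\<Sum>b'\<in>Poly_Mapping.keys y. if b' = b then lookup x a * lookup y b else 0) else 0)"
    by (intro sum.cong) auto
  also have "\<dots> = lookup x a * lookup y b"
    by (auto simp: in_keys_iff)
  finally show ?thesis .
qed

lemma pair_vec_eqI: "(\<And>a b. lookup z (a, b) = lookup z' (a, b)) \<Longrightarrow> z = z'"
  by (rule poly_mapping_eqI) auto

lemma tensor_vec_bilinear:
  "tensor_vec (x + x') y = tensor_vec x y + tensor_vec x' y"
  "tensor_vec x (y + y') = tensor_vec x y + tensor_vec x y'"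
  "tensor_vec (x - x') y = tensor_vec x y - tensor_vec x' y"
  "tensor_vec x (y - y') = tensor_vec x y - tensor_vec x y'"
  "tensor_vec (cscale c x) y = cscale c (tensor_vec x y)"
  "tensor_vec x (cscale c y) = cscale c (tensor_vec x y)"
  "tensor_vec x 0 = 0" "tensor_vec 0 y = 0"
  by (rule pair_vec_eqI; simp add: lookup_add lookup_minus algebra_simps)+

lemma clinear_tensor_vec: "clinear (\<lambda>x. tensor_vec x y)" "clinear (tensor_vec x)"
  by (rule clinearI; simp add: tensor_vec_bilinear)+

lemma tensor_vec_single: "tensor_vec (single a 1) (single b 1) = single (a, b) 1"
  by (rule pair_vec_eqI) (auto simp: lookup_single when_def)

text \<open>
  Pure tensors span, so the relations for a tensor product need only be checked on them, where
  the coproduct formulas apply directly.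
\<close>

lemma clinear_tensor_eqI:
  assumes "clinear f" "clinear g" "\<And>x y. f (tensor_vec x y) = g (tensor_vec x y)"
  shows "f z = g z"
proof (rule clinear_eqI [OF assms(1,2)])
  fix p :: "'a \<times> 'b"
  show "f (single p 1) = g (single p 1)"
    using assms(3) [of "single (fst p) 1" "single (snd p) 1"] by (simp add: tensor_vec_single)
qed

lemma clinear_tensor_op: "clinear (tensor_op f g)"
  by (simp add: tensor_op_def clinear_lin_ext)

lemma tensor_op_tensor_vec [simp]:
  assumes f: "clinear f" and g: "clinear g"
  shows "tensor_op f g (tensor_vec x y) = tensor_vec (f x) (g y)"
proof -
  have "tensor_op f g (tensor_vec (single a 1) y) = tensor_vec (f (single a 1)) (g y)" for a
  proof (rule clinear_eqI [where f = "\<lambda>y. tensor_op f g (tensor_vec (single a 1) y)"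
        and g = "\<lambda>y. tensor_vec (f (single a 1)) (g y)"])
    show "tensor_op f g (tensor_vec (single a 1) (single b 1)) =
        tensor_vec (f (single a 1)) (g (single b 1))" for b
      by (simp add: tensor_vec_single tensor_op_def)
  qed (rule clinear_compose [OF clinear_tensor_vec(2) clinear_tensor_op]
         clinear_compose [OF g clinear_tensor_vec(2)])+
  then show ?thesis
    by (rule clinear_eqI [OF clinear_compose [OF clinear_tensor_vec(1) clinear_tensor_op]
          clinear_compose [OF f clinear_tensor_vec(1)]])
qed

section \<open>Modules over the quantum group\<close>

locale uq_module =
  fixes t :: complex and R :: "'b uq_rep"
  assumes t: "Re t \<noteq> 0" and rep: "is_uq_rep t R"
begin

abbreviation "E \<equiv> opE R"
abbreviation "F \<equiv> opF R"
abbreviation "K \<equiv> opK R"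
abbreviation "K' \<equiv> opKi R"
abbreviation "d \<equiv> qpow t 1 - qpow t (- 1)"

lemma clinear_ops: "clinear E" "clinear F" "clinear K" "clinear K'"
  using rep by (simp_all add: is_uq_rep_def)

lemmas linear_simps =
  clinear_rules [OF clinear_ops(1)] clinear_rules [OF clinear_ops(2)]
  clinear_rules [OF clinear_ops(3)] clinear_rules [OF clinear_ops(4)]

lemma KK' [simp]: "K (K' x) = x" "K' (K x) = x"
  using rep by (simp_all add: is_uq_rep_def)

lemma EF_commutator: "E (F x) - F (E x) = cscale (1 / d) (K x - K' x)"
  using rep by (simp add: is_uq_rep_def)

text \<open>
  The commutation relations are oriented so that rewriting moves \<open>q\<^sup>h\<close> and its inverse to the
  left of \<open>E\<close> and \<open>F\<close>, and \<open>E\<close> to the right of \<open>F\<close>.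
\<close>

lemma EF: "E (F x) = F (E x) + cscale (1 / d) (K x - K' x)"
  using EF_commutator [of x] by (simp add: algebra_simps)

lemma E_K': "E (K' x) = cscale (qpow t 2) (K' (E x))"
proof -
  have "K (E (K' x)) = cscale (qpow t 2) (E x)"
    using rep by (simp add: is_uq_rep_def)
  then have "K' (K (E (K' x))) = cscale (qpow t 2) (K' (E x))"
    by (simp only: linear_simps)
  then show ?thesis by simp
qed

lemma F_K': "F (K' x) = cscale (qpow t (- 2)) (K' (F x))"
proof -
  have "K (F (K' x)) = cscale (qpow t (- 2)) (F x)"
    using rep by (simp add: is_uq_rep_def)
  then have "K' (K (F (K' x))) = cscale (qpow t (- 2)) (K' (F x))"
    by (simp only: linear_simps)
  then show ?thesis by simp
qed

lemma E_K: "E (K x) = cscale (qpow t (- 2)) (K (E x))"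
proof -
  have "K (E (K' (K x))) = cscale (qpow t 2) (E (K x))"
    using rep unfolding is_uq_rep_def by blast
  then have "cscale (qpow t (- 2)) (K (E x)) = cscale (qpow t (- 2)) (cscale (qpow t 2) (E (K x)))"
    by simp
  then show ?thesis by (simp flip: qpow_add)
qed

lemma F_K: "F (K x) = cscale (qpow t 2) (K (F x))"
proof -
  have "K (F (K' (K x))) = cscale (qpow t (- 2)) (F (K x))"
    using rep unfolding is_uq_rep_def by blast
  then have "cscale (qpow t 2) (K (F x)) = cscale (qpow t 2) (cscale (qpow t (- 2)) (F (K x)))"
    by simp
  then show ?thesis by (simp flip: qpow_add)
qed

end

section \<open>The tensor product of two modules\<close>

lemma clinear_tensor_rep:
  "clinear (opE (tensor_rep R S))" "clinear (opF (tensor_rep R S))"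
  "clinear (opK (tensor_rep R S))" "clinear (opKi (tensor_rep R S))"
  by (simp_all add: tensor_rep_def clinear_tensor_op clinear_add)

lemma tensor_rep_tensor_vec:
  assumes "is_uq_rep t R" "is_uq_rep t S"
  shows
    "opE (tensor_rep R S) (tensor_vec x y) =
       tensor_vec (opE R x) (opK S y) + tensor_vec x (opE S y)"
    "opF (tensor_rep R S) (tensor_vec x y) =
       tensor_vec (opF R x) y + tensor_vec (opKi R x) (opF S y)"
    "opK (tensor_rep R S) (tensor_vec x y) = tensor_vec (opK R x) (opK S y)"
    "opKi (tensor_rep R S) (tensor_vec x y) = tensor_vec (opKi R x) (opKi S y)"
  using assms by (simp_all add: tensor_rep_def is_uq_rep_def clinear_id)

lemma tensor_rep_is_uq_rep:
  assumes t: "Re t \<noteq> 0" and R: "is_uq_rep t R" and S: "is_uq_rep t S"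
  shows "is_uq_rep t (tensor_rep R S)"
proof -
  interpret R: uq_module t R by unfold_locales fact+
  interpret S: uq_module t S by unfold_locales fact+
  let ?T = "tensor_rep R S"
  note T = tensor_rep_tensor_vec [OF R S]
  note lin = clinear_tensor_rep [of R S]
  note simps = T R.linear_simps S.linear_simps tensor_vec_bilinear clinear_rules [OF lin(1)]
    clinear_rules [OF lin(2)] clinear_rules [OF lin(3)] clinear_rules [OF lin(4)]
  have [simp]: "qpow t 2 * qpow t (- 2) = 1" "qpow t (- 2) * qpow t 2 = 1"
    by (simp_all flip: qpow_add)
  have "opK ?T (opKi ?T z) = z" for z
    by (rule clinear_tensor_eqI [where f = "\<lambda>z. opK ?T (opKi ?T z)" and g = "\<lambda>z. z"],
        intro clinear_compose [OF lin(4) lin(3)], rule clinear_ident, simp add: simps)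
  moreover have "opKi ?T (opK ?T z) = z" for z
    by (rule clinear_tensor_eqI [where f = "\<lambda>z. opKi ?T (opK ?T z)" and g = "\<lambda>z. z"],
        intro clinear_compose [OF lin(3) lin(4)], rule clinear_ident, simp add: simps)
  moreover have "opK ?T (opE ?T (opKi ?T z)) = cscale (qpow t 2) (opE ?T z)" for z
    by (rule clinear_tensor_eqI [where f = "\<lambda>z. opK ?T (opE ?T (opKi ?T z))"
          and g = "\<lambda>z. cscale (qpow t 2) (opE ?T z)"],
        rule clinear_compose [OF clinear_compose [OF lin(4) lin(1)] lin(3)],
        intro clinear_cscale lin,
        simp add: simps R.E_K' S.E_K' cvec.scale_right_distrib)
  moreover have "opK ?T (opF ?T (opKi ?T z)) = cscale (qpow t (- 2)) (opF ?T z)" for z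
    by (rule clinear_tensor_eqI [where f = "\<lambda>z. opK ?T (opF ?T (opKi ?T z))"
          and g = "\<lambda>z. cscale (qpow t (- 2)) (opF ?T z)"],
        rule clinear_compose [OF clinear_compose [OF lin(4) lin(2)] lin(3)],
        intro clinear_cscale lin,
        simp add: simps R.F_K' S.F_K' cvec.scale_right_distrib)
  moreover have "opE ?T (opF ?T z) - opF ?T (opE ?T z) =
      cscale (1 / (qpow t 1 - qpow t (- 1))) (opK ?T z - opKi ?T z)" for z
  proof (rule clinear_tensor_eqI [where f = "\<lambda>z. opE ?T (opF ?T z) - opF ?T (opE ?T z)"
        and g = "\<lambda>z. cscale (1 / (qpow t 1 - qpow t (- 1))) (opK ?T z - opKi ?T z)"])
    fix x y
    \<comment> \<open>The mixed terms \<open>E q\<^sup>-\<^sup>h \<otimes> q\<^sup>h F\<close> and \<open>q\<^sup>-\<^sup>h E \<otimes> F q\<^sup>h\<close> cancel: moving \<open>q\<^sup>h\<close> to the left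
      produces the same factor \<open>q\<^sup>2\<close> in both.\<close>
    have "opE ?T (opF ?T (tensor_vec x y)) - opF ?T (opE ?T (tensor_vec x y)) =
        tensor_vec (opE R (opF R x) - opF R (opE R x)) (opK S y) +
        tensor_vec (opKi R x) (opE S (opF S y) - opF S (opE S y))"
      by (simp add: simps R.E_K' S.F_K algebra_simps)
    also have "\<dots> = cscale (1 / (qpow t 1 - qpow t (- 1)))
        (opK ?T (tensor_vec x y) - opKi ?T (tensor_vec x y))"
      unfolding R.EF_commutator S.EF_commutator
      by (simp add: simps cvec.scale_right_diff_distrib)
    finally show "opE ?T (opF ?T (tensor_vec x y)) - opF ?T (opE ?T (tensor_vec x y)) =
        cscale (1 / (qpow t 1 - qpow t (- 1)))
        (opK ?T (tensor_vec x y) - opKi ?T (tensor_vec x y))" .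
  qed (intro lin clinear_minus clinear_cscale clinear_compose [OF lin(1) lin(2)]
         clinear_compose [OF lin(2) lin(1)])+
  ultimately show ?thesis
    unfolding is_uq_rep_def using lin by blast
qed

section \<open>The Casimir element and nilpotency of \<open>E\<close>\<close>

context uq_module
begin

definition casimir :: "('b \<Rightarrow>\<^sub>0 complex) \<Rightarrow> ('b \<Rightarrow>\<^sub>0 complex)" where
  "casimir x = F (E x) + cscale (1 / d ^ 2) (cscale (qpow t 1) (K x) + cscale (qpow t (- 1)) (K' x))"

lemma clinear_casimir: "clinear casimir"
  unfolding casimir_def
  by (intro clinear_add clinear_cscale clinear_ops clinear_compose [OF clinear_ops(1,2)])

lemma d_nz: "d \<noteq> 0"
  by (rule q_minus_q_inverse_nz [OF t])

text \<open>
  The Casimir element is central: in \<open>[E, casimir]\<close> the commutator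
  \<open>(q\<^sup>h - q\<^sup>-\<^sup>h) / (q - q\<^sup>-\<^sup>1)\<close> of \<open>E\<close> and \<open>F\<close> cancels against what arises from moving \<open>E\<close> past
  \<open>q q\<^sup>h + q\<^sup>-\<^sup>1 q\<^sup>-\<^sup>h\<close>. The computation is done coordinatewise, in the field of scalars.
\<close>

lemma casimir_E: "E (casimir x) = casimir (E x)"
proof (rule poly_mapping_eqI)
  fix b
  define k k' q where "k = lookup (K (E x)) b" and "k' = lookup (K' (E x)) b" and "q = qpow t 1"
  have q: "q \<noteq> 0" by (simp add: q_def)
  note * = qpow_as_power [of t, folded q_def]
  have d: "q - 1 / q \<noteq> 0" using d_nz by (simp add: * q_def [symmetric])
  have "lookup (E (casimir x)) b = lookup (F (E (E x))) b + (k - k') / (q - 1 / q)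
      + (k / q + q * k') / (q - 1 / q) ^ 2"
    using q by (simp add: casimir_def linear_simps EF E_K E_K' lookup_add lookup_minus
        k_def [symmetric] k'_def [symmetric] q_def [symmetric] * power2_eq_square)
  also have "(k - k') / (q - 1 / q) = (k - k') * (q - 1 / q) / (q - 1 / q) ^ 2"
    using d by (simp add: power2_eq_square)
  also have "lookup (F (E (E x))) b + (k - k') * (q - 1 / q) / (q - 1 / q) ^ 2
      + (k / q + q * k') / (q - 1 / q) ^ 2 =
      lookup (F (E (E x))) b + ((k - k') * (q - 1 / q) + (k / q + q * k')) / (q - 1 / q) ^ 2"
    by (simp add: add_divide_distrib)
  also have "(k - k') * (q - 1 / q) + (k / q + q * k') = q * k + k' / q"
    using q by (simp add: field_simps)
  finally show "lookup (E (casimir x)) b = lookup (casimir (E x)) b"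
    using q by (simp add: casimir_def linear_simps lookup_add
        k_def [symmetric] k'_def [symmetric] q_def [symmetric] * power2_eq_square)
qed

lemma casimir_F: "F (casimir x) = casimir (F x)"
proof (rule poly_mapping_eqI)
  fix b
  define k k' q where "k = lookup (K (F x)) b" and "k' = lookup (K' (F x)) b" and "q = qpow t 1"
  have q: "q \<noteq> 0" by (simp add: q_def)
  note * = qpow_as_power [of t, folded q_def]
  have d: "q - 1 / q \<noteq> 0" using d_nz by (simp add: * q_def [symmetric])
  have "lookup (casimir (F x)) b = lookup (F (F (E x))) b + (q ^ 2 * k - k' / q ^ 2) / (q - 1 / q)
      + (q * k + k' / q) / (q - 1 / q) ^ 2"
    using q by (simp add: casimir_def linear_simps EF F_K F_K' lookup_add lookup_minus
        k_def [symmetric] k'_def [symmetric] q_def [symmetric] * power2_eq_square)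
  also have "(q ^ 2 * k - k' / q ^ 2) / (q - 1 / q) =
      (q ^ 2 * k - k' / q ^ 2) * (q - 1 / q) / (q - 1 / q) ^ 2"
    using d by (simp add: power2_eq_square)
  also have "lookup (F (F (E x))) b + (q ^ 2 * k - k' / q ^ 2) * (q - 1 / q) / (q - 1 / q) ^ 2
      + (q * k + k' / q) / (q - 1 / q) ^ 2 =
      lookup (F (F (E x))) b +
      ((q ^ 2 * k - k' / q ^ 2) * (q - 1 / q) + (q * k + k' / q)) / (q - 1 / q) ^ 2"
    by (simp add: add_divide_distrib)
  also have "(q ^ 2 * k - k' / q ^ 2) * (q - 1 / q) + (q * k + k' / q) = q ^ 3 * k + k' / q ^ 3"
    using q by (simp add: field_simps power2_eq_square power3_eq_cube)
  finally show "lookup (F (casimir x)) b = lookup (casimir (F x)) b"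
    using q by (simp add: casimir_def linear_simps F_K F_K' lookup_add
        k_def [symmetric] k'_def [symmetric] q_def [symmetric] *
        power2_eq_square power3_eq_cube mult.assoc)
qed

lemma casimir_K: "K (casimir x) = casimir (K x)"
proof -
  have "F (E (K x)) = K (F (E x))"
    by (simp add: E_K F_K linear_simps flip: qpow_add)
  then show ?thesis by (simp add: casimir_def linear_simps)
qed

lemma casimir_K': "K' (casimir x) = casimir (K' x)"
  using casimir_K [of "K' x"] by (metis KK')

lemma is_subrepI:
  assumes "clinear f"
    and "\<And>x. f x = 0 \<Longrightarrow> f (E x) = 0" "\<And>x. f x = 0 \<Longrightarrow> f (F x) = 0"
      "\<And>x. f x = 0 \<Longrightarrow> f (K x) = 0" "\<And>x. f x = 0 \<Longrightarrow> f (K' x) = 0"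
  shows "is_subrep R {x. f x = 0}"
  using assms by (auto simp: is_subrep_def cvec.subspace_def clinear_rules [OF assms(1)])

lemma weight_K': "x \<in> weight_space t R \<nu> \<Longrightarrow> K' x = cscale (qpow t (- \<nu>)) x"
proof -
  assume "x \<in> weight_space t R \<nu>"
  then have "cscale (qpow t (- \<nu>)) (K' (K x)) = cscale (qpow t (- \<nu>)) (cscale (qpow t \<nu>) (K' x))"
    by (simp only: weight_space_def mem_Collect_eq linear_simps)
  then show ?thesis by (simp flip: qpow_add)
qed

lemma weight_E: "x \<in> weight_space t R \<nu> \<Longrightarrow> E x \<in> weight_space t R (\<nu> + 2)"
proof -
  assume "x \<in> weight_space t R \<nu>"
  then have "cscale (qpow t 2) (E (K x)) = cscale (qpow t 2) (cscale (qpow t \<nu>) (E x))"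
    by (simp add: weight_space_def linear_simps)
  then show ?thesis
    by (simp add: E_K weight_space_def add.commute flip: qpow_add)
qed

lemma E_power_K: "(E ^^ n) (K x) = cscale (qpow t (- 2) ^ n) (K ((E ^^ n) x))"
  by (induction n) (simp_all add: E_K linear_simps mult.commute)

lemma E_power_K': "(E ^^ n) (K' x) = cscale (qpow t 2 ^ n) (K' ((E ^^ n) x))"
  by (induction n) (simp_all add: E_K' linear_simps mult.commute)

text \<open>
  Commuting \<open>F\<close> past \<open>E\<close> costs only terms in \<open>q\<^sup>h\<close>, which preserve the kernel of a power of \<open>E\<close>;
  hence one more power suffices.
\<close>

lemma E_power_F: "(E ^^ n) x = 0 \<Longrightarrow> (E ^^ Suc n) (F x) = 0"
proof (induction n arbitrary: x)
  case 0
  then show ?case by (simp add: linear_simps)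
next
  case (Suc n)
  note comm = E_power_K E_power_K' and lin = clinear_funpow [OF clinear_ops(1)]
  have "(E ^^ Suc n) (F (E x)) = 0"
    using Suc by (simp add: funpow_swap1)
  moreover have "(E ^^ Suc n) (K x) = 0" "(E ^^ Suc n) (K' x) = 0"
    using Suc.prems by (simp_all only: comm linear_simps cvec.scale_zero_right)
  moreover have "(E ^^ Suc (Suc n)) (F x) = (E ^^ Suc n) (E (F x))"
    by (simp add: funpow_swap1)
  ultimately show ?case
    by (simp only: EF clinear_rules [OF lin] diff_self cvec.scale_zero_right add_0_left)
qed

text \<open>
  In an irreducible module this subrepresentation is everything as soon as there is a highest weight
  vector. That bounds the weights from above without a description of all of them.
\<close>

lemma is_subrep_nilpotent: "is_subrep R {x. \<exists>n. (E ^^ n) x = 0}"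
proof -
  note comm = E_power_K E_power_K' and lin = clinear_funpow [OF clinear_ops(1)]
  have up: "(E ^^ (k + n)) x = 0" if "(E ^^ n) x = 0" for k n x
    by (simp add: funpow_add that clinear_rules [OF lin])
  have "\<exists>n. (E ^^ n) (x + y) = 0" if "(E ^^ n) x = 0" "(E ^^ k) y = 0" for n k x y
    using up [OF that(1), of k] up [OF that(2), of n]
    by (intro exI [of _ "k + n"]) (simp add: clinear_rules [OF lin] add.commute)
  moreover have "\<exists>n. (E ^^ n) (cscale c x) = 0" if "(E ^^ n) x = 0" for n c x
    using that by (intro exI [of _ n]) (simp add: clinear_rules [OF lin])
  moreover have "\<exists>n. (E ^^ n) (E x) = 0" if "(E ^^ n) x = 0" for n x
    using that by (intro exI [of _ n]) (simp add: linear_simps flip: funpow_swap1)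
  moreover have "\<exists>n. (E ^^ n) (F x) = 0" if "(E ^^ n) x = 0" for n x
    using E_power_F [OF that] by blast
  moreover have "\<exists>n. (E ^^ n) (K x) = 0" "\<exists>n. (E ^^ n) (K' x) = 0" if "(E ^^ n) x = 0" for n x
    using that by (auto intro!: exI [of _ n] simp: comm linear_simps)
  moreover have "\<exists>n. (E ^^ n) 0 = 0" by (intro exI [of _ 0]) simp
  ultimately show ?thesis
    unfolding is_subrep_def cvec.subspace_def by blast
qed

end

section \<open>The zero weight space of an irreducible module\<close>

locale irreducible_module = uq_module t R for t and R :: "'b uq_rep" +
  fixes m :: nat
  assumes irred: "irreducible_rep t R" and highest: "has_highest_weight t R (2 * of_nat m)"
begin

lemma subrep_UNIV: "is_subrep R S \<Longrightarrow> x \<in> S \<Longrightarrow> x \<noteq> 0 \<Longrightarrow> y \<in> S"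
  using irred unfolding irreducible_rep_def by blast

text \<open>
  The Casimir element acts by the scalar that it has on the highest weight vector, because its
  eigenspace is a nonzero subrepresentation. On a weight vector this determines \<open>F E\<close>.
\<close>

lemma FE_weight:
  assumes x: "x \<in> weight_space t R (2 * j)"
  shows "F (E x) = cscale (qnum t (of_nat m - j) * qnum t (of_nat m + j + 1)) x"
proof -
  obtain v where v: "v \<noteq> 0" "E v = 0" "v \<in> weight_space t R (2 * of_nat m)"
    using highest by (auto simp: has_highest_weight_def)
  have cas: "casimir x = F (E x) +
      cscale ((qpow t (1 + \<nu>) + qpow t (- 1 - \<nu>)) / d ^ 2) x" if "x \<in> weight_space t R \<nu>" for x \<nu>
    using that weight_K' [OF that] unfolding weight_space_def casimir_def
    by (simp add: cvec.scale_left_distrib add_divide_distrib cvec.scale_right_distrib 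
        flip: qpow_add)
  define c where "c = (qpow t (1 + 2 * of_nat m) + qpow t (- 1 - 2 * of_nat m)) / d ^ 2"
  define f where "f x = casimir x - cscale c x" for x
  have f: "clinear f"
    unfolding f_def by (intro clinear_minus clinear_casimir clinear_cscale clinear_ident)
  have "f v = 0"
    by (simp add: f_def cas [OF v(3)] v(2) linear_simps c_def)
  moreover have "is_subrep R {x. f x = 0}"
    by (intro is_subrepI f)
       (simp_all add: f_def flip: casimir_E casimir_F casimir_K casimir_K',
        simp_all add: linear_simps)
  ultimately have "f x = 0"
    using subrep_UNIV [of "{x. f x = 0}" v x] v(1) by simp
  then have "F (E x) = cscale (c - (qpow t (1 + 2 * j) + qpow t (- 1 - 2 * j)) / d ^ 2) x"
    by (simp add: f_def cas [OF x] cvec.scale_left_diff_distrib) (metis add_diff_cancel_right')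
  also have "c - (qpow t (1 + 2 * j) + qpow t (- 1 - 2 * j)) / d ^ 2 =
      qnum t (of_nat m - j) * qnum t (of_nat m + j + 1)"
    unfolding qnum_mult c_def by (simp add: algebra_simps diff_divide_distrib add_divide_distrib)
  finally show ?thesis .
qed

context
  fixes w0 assumes w0: "w0 \<in> weight_space t R 0"
begin

lemma weight_E_power: "(E ^^ k) w0 \<in> weight_space t R (2 * of_nat k)"
proof (induction k)
  case (Suc k)
  then show ?case using weight_E [OF Suc] by (simp add: algebra_simps)
qed (simp add: w0)

lemma F_E_power_Suc:
  "F ((E ^^ Suc k) w0) = cscale (qnum t (of_nat m - of_nat k) * qnum t (of_nat (m + k + 1))) ((E ^^ k) w0)"
  using FE_weight [OF weight_E_power [of k]] by (simp add: add.commute add.left_commute)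

text \<open>
  If the vector \<open>E\<^sup>m\<^sup>+\<^sup>1 w\<^sub>0\<close> were nonzero, then so would be all higher \<open>E\<^sup>k w\<^sub>0\<close>, because the
  factors \<open>[m - k] [m + k + 1]\<close> of \<open>F E\<close> no longer vanish for \<open>k > m\<close>. This contradicts the
  nilpotency of \<open>E\<close>.
\<close>

lemma E_power_eq_0: "(E ^^ Suc m) w0 = 0"
proof (rule ccontr)
  assume nz: "(E ^^ Suc m) w0 \<noteq> 0"
  have "(E ^^ (Suc m + k)) w0 \<noteq> 0" for k
  proof (induction k)
    case (Suc k)
    have "qnum t (of_int (- (int k + 1))) \<noteq> 0" "qnum t (of_nat (m + (Suc m + k) + 1)) \<noteq> 0"
      by (rule qnum_of_int_nz [OF t] qnum_of_nat_nz [OF t]; simp)+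
    moreover have "of_nat m - of_nat (Suc m + k) = (of_int (- (int k + 1)) :: complex)" by simp
    ultimately have "F ((E ^^ Suc (Suc m + k)) w0) \<noteq> 0"
      unfolding F_E_power_Suc using Suc by (simp only: cvec.scale_eq_0_iff mult_eq_0_iff) simp
    then show ?case
      using linear_simps(10) by auto
  qed (use nz in simp)
  moreover obtain n where "(E ^^ n) w0 = 0"
  proof -
    obtain v where v: "v \<noteq> 0" "E v = 0" 
      using highest by (auto simp: has_highest_weight_def)
    then have "(E ^^ 1) v = 0" by simp
    then have "v \<in> {x. \<exists>n. (E ^^ n) x = 0}" by blast
    from subrep_UNIV [OF is_subrep_nilpotent this v(1)] that show ?thesis by blast
  qed
  then have "(E ^^ (Suc m + n)) w0 = 0"
    unfolding funpow_add o_apply by (induction m) (simp_all add: linear_simps)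
  ultimately show False by blast
qed

lemma F_power_E_power:
  "(F ^^ k) ((E ^^ k) w0) =
     cscale (\<Prod>j<k. qnum t (of_nat m - of_nat j) * qnum t (of_nat (m + j + 1))) w0"
proof (induction k)
  case (Suc k)
  have "(F ^^ Suc k) ((E ^^ Suc k) w0) = (F ^^ k) (F ((E ^^ Suc k) w0))"
    by (simp only: funpow_Suc_right o_apply)
  then show ?case
    by (simp only: F_E_power_Suc clinear_rules [OF clinear_funpow [OF clinear_ops(2)]] Suc.IH cvec.scale_scale)
       (simp add: mult.commute)
qed simp

end

end

section \<open>Gaussian binomial coefficients\<close>

text \<open>
  The coefficient of \<open>a\<^sup>n\<^sup>-\<^sup>i b\<^sup>i\<close> in \<open>(a + b)\<^sup>n\<close> when \<open>b a = Q a b\<close>; the two summands of the coproduct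
  of \<open>F\<close> are such a pair, with \<open>Q = q\<^sup>2\<close>. Of the two Pascal rules this is the one that gives a
  recursion for the generating functions at a fixed argument.
\<close>

fun qbin :: "complex \<Rightarrow> nat \<Rightarrow> nat \<Rightarrow> complex" where
  "qbin Q n 0 = 1"
| "qbin Q 0 (Suc i) = 0"
| "qbin Q (Suc n) (Suc i) = Q ^ Suc i * qbin Q n (Suc i) + qbin Q n i"

text \<open>
  The solution of the recursion is the Cauchy product of the input with a geometric series. Absolute
  convergence is part of the conclusion so that the lemma can be iterated.
\<close>

lemma linear_recursion_sums:
  fixes a b :: "nat \<Rightarrow> complex"
  assumes r: "norm r < 1" and b: "summable (\<lambda>n. norm (b n))" "b sums B"
    and a: "a 0 = 0" "\<And>n. a (Suc n) = r * a n + b n"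
  shows "summable (\<lambda>n. norm (a n))" "a sums (B / (1 - r))"
proof -
  have a_Suc: "a (Suc n) = (\<Sum>i\<le>n. r ^ i * b (n - i))" for n
    by (induction n) (use a in \<open>simp_all add: sum_distrib_left sum.atMost_Suc_shift mult.assoc
      del: sum.atMost_Suc\<close>)
  have geo: "summable (\<lambda>n. norm (r ^ n))"
    using r by (simp add: norm_power)
  have "summable (\<lambda>n. \<Sum>i\<le>n. norm (r ^ i) * norm (b (n - i)))"
    using summable_Cauchy_product [of "\<lambda>n. norm (r ^ n)" "\<lambda>n. norm (b n)"] geo b(1) by simp
  then have "summable (\<lambda>n. norm (a (Suc n)))"
    by (rule summable_comparison_test') (simp add: a_Suc, intro sum_norm_le, simp add: norm_mult)
  then show "summable (\<lambda>n. norm (a n))"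
    by (subst (asm) summable_Suc_iff)
  have "(\<lambda>n. a (Suc n)) sums (suminf (\<lambda>n. r ^ n) * suminf b)"
    unfolding a_Suc by (rule Cauchy_product_sums [OF geo b(1)])
  moreover have "suminf (\<lambda>n. r ^ n) * suminf b = B / (1 - r)"
    using suminf_geometric [OF r] sums_unique [OF b(2)] by simp
  ultimately show "a sums (B / (1 - r))"
    using a(1) by (simp add: sums_Suc_iff)
qed

lemma qbin_sums:
  assumes "\<And>j. j \<le> i \<Longrightarrow> norm (Q ^ j * x) < 1"
  shows "summable (\<lambda>n. norm (x ^ n * qbin Q n i))"
    "(\<lambda>n. x ^ n * qbin Q n i) sums (x ^ i / (\<Prod>j\<le>i. 1 - Q ^ j * x))"
proof -
  have "summable (\<lambda>n. norm (x ^ n * qbin Q n i)) \<and>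
      (\<lambda>n. x ^ n * qbin Q n i) sums (x ^ i / (\<Prod>j\<le>i. 1 - Q ^ j * x))"
    using assms
  proof (induction i)
    case 0
    from 0 [of 0] show ?case by (simp add: norm_power geometric_sums)
  next
    case (Suc i)
    let ?b = "\<lambda>n. x * (x ^ n * qbin Q n i)"
    have IH: "summable (\<lambda>n. norm (x ^ n * qbin Q n i))"
      "(\<lambda>n. x ^ n * qbin Q n i) sums (x ^ i / (\<Prod>j\<le>i. 1 - Q ^ j * x))"
      using Suc by auto
    have r: "norm (Q ^ Suc i * x) < 1" by (rule Suc.prems) simp
    have b: "summable (\<lambda>n. norm (?b n))" "?b sums (x * (x ^ i / (\<Prod>j\<le>i. 1 - Q ^ j * x)))"
      using summable_mult [OF IH(1), of "norm x"] sums_mult [OF IH(2), of x]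
      by (simp_all add: norm_mult)
    have "x ^ Suc n * qbin Q (Suc n) (Suc i) = Q ^ Suc i * x * (x ^ n * qbin Q n (Suc i)) + ?b n" for n
      by (simp add: algebra_simps)
    from linear_recursion_sums [OF r b, of "\<lambda>n. x ^ n * qbin Q n (Suc i)", OF _ this]
    show ?case by (simp add: mult.commute)
  qed
  then show "summable (\<lambda>n. norm (x ^ n * qbin Q n i))"
    "(\<lambda>n. x ^ n * qbin Q n i) sums (x ^ i / (\<Prod>j\<le>i. 1 - Q ^ j * x))" by auto
qed

section \<open>The tensor product of a Verma module with \<open>V\<close>\<close>

text \<open>
  The number \<open>(- 1)\<^sup>k q\<^bsup>k (k - 1)\<^esup> (q - q\<^sup>-\<^sup>1)\<^sup>k [m + k]! / ([k]! [m - k]!)\<close> for \<open>k \<le> m\<close>, as a product so that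
  it matches the recursive form of the singular vector.
\<close>

definition trace_coeff :: "complex \<Rightarrow> nat \<Rightarrow> nat \<Rightarrow> complex" where
  "trace_coeff t m k = (\<Prod>j<k. - qpow t (2 * of_nat j) * (qpow t 1 - qpow t (- 1)) *
     (qnum t (of_nat m - of_nat j) * qnum t (of_nat (m + j + 1))) / qnum t (of_nat (Suc j)))"

context uq_module
begin

abbreviation "T \<mu> \<equiv> tensor_rep (verma t \<mu>) R"

lemmas T_tensor_vec = tensor_rep_tensor_vec [OF verma_is_uq_rep [OF t] rep]

lemma single_scale: "single a c = cscale c (single a 1)"
  by simp

lemma T_single:
  "opE (T \<mu>) (tensor_vec (single k 1) y) =
     cscale (qnum t (of_nat k) * qnum t (\<mu> - of_nat k + 1)) (tensor_vec (single (k - 1) 1) (K y)) +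
     tensor_vec (single k 1) (E y)"
  "opF (T \<mu>) (tensor_vec (single k 1) y) =
     tensor_vec (single (Suc k) 1) y +
     cscale (qpow t (- (\<mu> - 2 * of_nat k))) (tensor_vec (single k 1) (F y))"
  "opK (T \<mu>) (tensor_vec (single k 1) y) =
     cscale (qpow t (\<mu> - 2 * of_nat k)) (tensor_vec (single k 1) (K y))"
  by (simp_all add: T_tensor_vec single_scale [of _ "_ * _"] single_scale [of _ "qpow _ _"]
      tensor_vec_bilinear del: cscale_single)

text \<open>
  The \<open>q\<close>-binomial theorem for \<open>\<Delta>(F)\<^sup>n\<close>. The first application of \<open>\<Delta>(F)\<close> is split off, which is
  why the statement is proved for all \<open>k\<close> and \<open>y\<close> at once.
\<close>

lemma lookup_F_power:
  "lookup ((opF (T \<mu>) ^^ n) (tensor_vec (single k 1) y)) (j, b) =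
     (if j \<le> n + k then
        qbin (qpow t 2) n (n + k - j) * qpow t (- (of_nat (n + k - j) * (\<mu> - 2 * of_nat k))) *
        lookup ((F ^^ (n + k - j)) y) b
      else 0)"
proof (induction n arbitrary: k y)
  case 0
  show ?case
  proof (cases "k - j")
    case (Suc i)
    then show ?thesis by (simp add: lookup_single)
  qed (auto simp: lookup_single when_def)
next
  case (Suc n)
  have "(opF (T \<mu>) ^^ Suc n) (tensor_vec (single k 1) y) =
      (opF (T \<mu>) ^^ n) (opF (T \<mu>) (tensor_vec (single k 1) y))"
    by (simp only: funpow_Suc_right o_apply)
  then have *: "lookup ((opF (T \<mu>) ^^ Suc n) (tensor_vec (single k 1) y)) (j, b) =
      lookup ((opF (T \<mu>) ^^ n) (tensor_vec (single (Suc k) 1) y)) (j, b) +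
      qpow t (- (\<mu> - 2 * of_nat k)) * lookup ((opF (T \<mu>) ^^ n) (tensor_vec (single k 1) (F y))) (j, b)"
    by (simp only: T_single clinear_rules [OF clinear_funpow [OF clinear_tensor_rep(2)]]
        lookup_add lookup_cscale)
  show ?case
  proof (cases "j \<le> n + k")
    case True
    define i where "i = n + k - j"
    have i: "n + Suc k - j = Suc i" "Suc n + k - j = Suc i" "n + k - j = i"
      using True by (simp_all add: i_def)
    have Fi: "(F ^^ i) (F y) = (F ^^ Suc i) y"
      by (simp only: funpow_Suc_right o_apply)
    have Q: "qpow t 2 ^ Suc i = qpow t (of_nat (Suc i) * 2)"
      by (simp only: qpow_of_nat_mult)
    have e1: "qpow t (- (of_nat (Suc i) * (\<mu> - 2 * of_nat (Suc k)))) =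
        qpow t (of_nat (Suc i) * 2) * qpow t (- (of_nat (Suc i) * (\<mu> - 2 * of_nat k)))"
      by (simp add: algebra_simps flip: qpow_add)
    have e2: "qpow t (- (of_nat (Suc i) * (\<mu> - 2 * of_nat k))) =
        qpow t (- (\<mu> - 2 * of_nat k)) * qpow t (- (of_nat i * (\<mu> - 2 * of_nat k)))"
      by (simp add: algebra_simps flip: qpow_add)
    have "j \<le> n + Suc k" "j \<le> Suc n + k" using True by auto
    then show ?thesis
      unfolding * Suc.IH i Fi qbin.simps(3) Q e1 using True
      by (simp only: if_True e2) (simp add: algebra_simps)
  next
    case False
    then show ?thesis
      unfolding * Suc.IH by (cases "j = Suc (n + k)") auto
  qed
qed

text \<open>
  The second tensor factor belonging to the basis vector \<open>F\<^sup>n v\<^sub>\<mu>\<close> of the first.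
\<close>

definition slice :: "nat \<Rightarrow> (nat \<times> 'b \<Rightarrow>\<^sub>0 complex) \<Rightarrow> ('b \<Rightarrow>\<^sub>0 complex)" where
  "slice n = lin_ext (\<lambda>(a, b). if a = n then single b 1 else 0)"

lemma clinear_slice: "clinear (slice n)"
  by (simp add: slice_def clinear_lin_ext)

lemma lookup_slice: "lookup (slice n z) b = lookup z (n, b)"
proof -
  have "lookup (slice n z) b =
      (\<Sum>p\<in>Poly_Mapping.keys z. if p = (n, b) then lookup z (n, b) else 0)"
    unfolding slice_def lin_ext_def lookup_sum
    by (intro sum.cong refl) (auto simp: lookup_single when_def split: prod.splits if_splits)
  then show ?thesis by (simp add: in_keys_iff)
qed

lemma slice_tensor_vec: "slice n (tensor_vec x y) = cscale (lookup x n) y"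
  by (rule poly_mapping_eqI) (simp add: lookup_slice)

lemma slice_E:
  "slice n (opE (T \<mu>) z) =
     cscale (qnum t (of_nat (Suc n)) * qnum t (\<mu> - of_nat n)) (K (slice (Suc n) z)) + E (slice n z)"
proof (rule clinear_eqI [where f = "\<lambda>z. slice n (opE (T \<mu>) z)" and
      g = "\<lambda>z. cscale (qnum t (of_nat (Suc n)) * qnum t (\<mu> - of_nat n)) (K (slice (Suc n) z)) +
        E (slice n z)"])
  show "clinear (\<lambda>z. slice n (opE (T \<mu>) z))"
    by (rule clinear_compose [OF clinear_tensor_rep(1) clinear_slice])
  show "clinear (\<lambda>z. cscale (qnum t (of_nat (Suc n)) * qnum t (\<mu> - of_nat n)) (K (slice (Suc n) z)) +
        E (slice n z))"
    by (intro clinear_add clinear_cscale clinear_compose [OF clinear_slice clinear_ops(1)]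
        clinear_compose [OF clinear_slice clinear_ops(3)])
  fix p :: "nat \<times> 'b"
  obtain a b where p: "p = (a, b)" by (cases p)
  show "slice n (opE (T \<mu>) (single p 1)) =
      cscale (qnum t (of_nat (Suc n)) * qnum t (\<mu> - of_nat n)) (K (slice (Suc n) (single p 1))) +
      E (slice n (single p 1))"
    unfolding p tensor_vec_single [symmetric] T_single
    by (cases a) (auto simp: clinear_rules [OF clinear_slice] slice_tensor_vec lookup_single when_def
        linear_simps algebra_simps)
qed

text \<open>
  A vector killed by \<open>E\<close> is determined by its component over \<open>v\<^sub>\<mu>\<close>: the relation
  \<open>[n + 1] [\<mu> - n] q\<^sup>h z\<^sub>n\<^sub>+\<^sub>1 + E z\<^sub>n = 0\<close> between consecutive slices can be solved for \<open>z\<^sub>n\<^sub>+\<^sub>1\<close> when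
  \<open>\<mu>\<close> is generic.
\<close>

lemma E_kernel_eq_0:
  assumes generic: "generic t \<mu>" and E: "opE (T \<mu>) z = 0" and low: "\<And>b. lookup z (0, b) = 0"
  shows "z = 0"
proof -
  have "slice n z = 0" for n
  proof (induction n)
    case 0
    show ?case by (rule poly_mapping_eqI) (simp add: lookup_slice low)
  next
    case (Suc n)
    have "qnum t (of_nat (Suc n)) * qnum t (\<mu> - of_nat n) \<noteq> 0"
      using qnum_of_nat_nz [OF t, of "Suc n"] generic by (simp add: generic_def del: of_nat_Suc)
    moreover have "cscale (qnum t (of_nat (Suc n)) * qnum t (\<mu> - of_nat n)) (K (slice (Suc n) z)) = 0"
      using slice_E [of n \<mu> z] E Suc by (simp add: clinear_rules [OF clinear_slice] linear_simps)
    ultimately have "K' (K (slice (Suc n) z)) = 0"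
      by (simp only: cvec.scale_eq_0_iff) (simp add: linear_simps)
    then show ?case by simp
  qed
  then show ?thesis
    by (intro pair_vec_eqI) (metis lookup_slice lookup_zero)
qed

end

section \<open>The intertwiner and its trace\<close>

context irreducible_module
begin

context
  fixes w0 \<mu> assumes w0: "w0 \<in> weight_space t R 0" and generic: "generic t \<mu>"
begin

text \<open>
  The factors by which \<open>E\<^sup>k w\<^sub>0\<close> has to be multiplied to solve the recursion between the slices.
\<close>

definition singular_coeff :: "nat \<Rightarrow> complex" where
  "singular_coeff k = (\<Prod>i<k. - qpow t (- 2 * (of_nat i + 1)) / (qnum t (of_nat (Suc i)) * qnum t (\<mu> - of_nat i)))"

definition singular_vec :: "nat \<times> 'b \<Rightarrow>\<^sub>0 complex" where
  "singular_vec = (\<Sum>k\<le>m. tensor_vec (single k 1) (cscale (singular_coeff k) ((E ^^ k) w0)))"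

lemma K_E_power: "K ((E ^^ k) w0) = cscale (qpow t (2 * of_nat k)) ((E ^^ k) w0)"
  using weight_E_power [OF w0, of k] by (simp add: weight_space_def)

text \<open>
  The two parts of the coproduct of \<open>E\<close> telescope against each other; what is left over at the
  upper end is \<open>E\<^sup>m\<^sup>+\<^sup>1 w\<^sub>0 = 0\<close>.
\<close>

lemma E_singular_vec: "opE (T \<mu>) singular_vec = 0"
proof -
  define A where "A k = cscale (qnum t (of_nat k) * qnum t (\<mu> - of_nat k + 1))
    (tensor_vec (single (k - 1) 1) (K (cscale (singular_coeff k) ((E ^^ k) w0))))" for k
  define B where "B k = tensor_vec (single k 1) (E (cscale (singular_coeff k) ((E ^^ k) w0)))" for k
  have "A (Suc k) + B k = 0" for k
  proof -
    have nz: "qnum t (of_nat (Suc k)) \<noteq> 0" "qnum t (\<mu> - of_nat k) \<noteq> 0"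
      using qnum_of_nat_nz [OF t, of "Suc k"] generic by (simp_all add: generic_def del: of_nat_Suc)
    have "singular_coeff (Suc k) * qpow t (2 * of_nat (Suc k)) *
        (qnum t (of_nat (Suc k)) * qnum t (\<mu> - of_nat k)) =
        - singular_coeff k * (qpow t (- 2 * (of_nat k + 1)) * qpow t (2 * of_nat (Suc k)))"
      using nz by (simp add: singular_coeff_def del: of_nat_Suc)
    also have "\<dots> = - singular_coeff k"
      by (simp add: algebra_simps flip: qpow_add)
    finally have *: "qnum t (of_nat (Suc k)) * qnum t (\<mu> - of_nat k) *
      (singular_coeff (Suc k) * qpow t (2 * of_nat (Suc k))) = - singular_coeff k" by (simp only: mult.commute)
    have "A (Suc k) = cscale (qnum t (of_nat (Suc k)) * qnum t (\<mu> - of_nat k) *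
      (singular_coeff (Suc k) * qpow t (2 * of_nat (Suc k)))) (tensor_vec (single k 1) ((E ^^ Suc k) w0))"
      by (simp only: A_def linear_simps K_E_power tensor_vec_bilinear cvec.scale_scale diff_Suc_1)
         (simp add: mult.assoc)
    also have "\<dots> = - B k"
      unfolding * by (simp add: B_def linear_simps tensor_vec_bilinear)
    finally show ?thesis by simp
  qed
  moreover have "A 0 = 0" by (simp add: A_def)
  ultimately have "(\<Sum>k\<le>n. A k + B k) = B n" for n
    by (induction n) (simp_all add: add.assoc [symmetric] add.commute)
  moreover have "opE (T \<mu>) singular_vec = (\<Sum>k\<le>m. A k + B k)"
    by (simp add: singular_vec_def clinear_rules [OF clinear_tensor_rep(1)] T_single A_def B_def)
  moreover have "B m = 0"
    using E_power_eq_0 [OF w0] by (simp add: B_def linear_simps tensor_vec_bilinear)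
  ultimately show ?thesis by simp
qed

lemma singular_vec_weight: "singular_vec \<in> weight_space t (T \<mu>) \<mu>"
proof -
  have "qpow t (\<mu> - 2 * of_nat k) * (singular_coeff k * qpow t (2 * of_nat k)) = qpow t \<mu> * singular_coeff k" for k
    by (simp add: mult.left_commute [of _ "singular_coeff k"] mult.commute [of _ "singular_coeff k"] flip: qpow_add)
  then have "singular_coeff k * (qpow t (\<mu> - 2 * of_nat k) * qpow t (2 * of_nat k)) = qpow t \<mu> * singular_coeff k" for k
    by (simp add: mult_ac)
  then show ?thesis
    unfolding singular_vec_def weight_space_def mem_Collect_eq clinear_rules [OF clinear_tensor_rep(3)]
      cvec.scale_sum_right
    by (intro sum.cong refl)
       (simp only: clinear_rules [OF clinear_tensor_rep(3)] T_single linear_simps K_E_power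
          tensor_vec_bilinear cvec.scale_scale mult_ac)
qed

lemma lookup_singular_vec_0: "lookup singular_vec (0, b) = lookup w0 b"
proof -
  have "lookup singular_vec (0, b) = (\<Sum>k\<le>m. if k = 0 then lookup w0 b else 0)"
    unfolding singular_vec_def lookup_sum
    by (intro sum.cong) (auto simp: lookup_single when_def singular_coeff_def)
  then show ?thesis by simp
qed

text \<open>
  The image of \<open>v\<^sub>\<mu>\<close> under an intertwiner is killed by \<open>E\<close>, so the prescribed component over \<open>v\<^sub>\<mu>\<close>
  fixes it completely. With the universal property of the Verma module this gives existence and
  uniqueness of \<open>\<Phi>\<^sub>\<mu>\<close>.
\<close>

lemma is_Phi_iff:
  "is_Phi t \<mu> R w0 \<Phi> \<longleftrightarrow> intertwiner (verma t \<mu>) (T \<mu>) \<Phi> \<and> \<Phi> (single 0 1) = singular_vec"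
proof
  have low: "lookup (z - tensor_vec (single 0 1) w0) (0, b) = lookup z (0, b) - lookup w0 b" for z b
    by (simp add: lookup_minus)
  {
    assume "is_Phi t \<mu> R w0 \<Phi>"
    then have \<Phi>: "intertwiner (verma t \<mu>) (T \<mu>) \<Phi>"
      and keys: "\<And>n b. (n, b) \<in> Poly_Mapping.keys (\<Phi> (single 0 1) - tensor_vec (single 0 1) w0)
        \<Longrightarrow> n > 0"
      by (auto simp: is_Phi_def)
    have "opE (T \<mu>) (\<Phi> (single 0 1)) = \<Phi> (opE (verma t \<mu>) (single 0 1))"
      using \<Phi> by (simp add: intertwiner_def del: verma_single)
    also have "\<dots> = 0"
      using \<Phi> by (simp add: intertwiner_def clinear_rules)
    finally have "opE (T \<mu>) (\<Phi> (single 0 1) - singular_vec) = 0"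
      by (simp add: clinear_rules [OF clinear_tensor_rep(1)] E_singular_vec)
    moreover have "lookup (\<Phi> (single 0 1) - singular_vec) (0, b) = 0" for b
      using keys [of 0 b] by (auto simp: in_keys_iff low lookup_minus lookup_singular_vec_0)
    ultimately have "\<Phi> (single 0 1) - singular_vec = 0"
      by (rule E_kernel_eq_0 [OF generic])
    with \<Phi> show "intertwiner (verma t \<mu>) (T \<mu>) \<Phi> \<and> \<Phi> (single 0 1) = singular_vec" by simp
  }
  assume "intertwiner (verma t \<mu>) (T \<mu>) \<Phi> \<and> \<Phi> (single 0 1) = singular_vec"
  then show "is_Phi t \<mu> R w0 \<Phi>"
    unfolding is_Phi_def by (auto simp: in_keys_iff low lookup_singular_vec_0 intro!: Nat.gr0I)
qed

lemma Phi_single: "Phi t \<mu> R w0 (single n 1) = (opF (T \<mu>) ^^ n) singular_vec"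
proof -
  have "\<exists>!\<Phi>. is_Phi t \<mu> R w0 \<Phi>"
    unfolding is_Phi_iff
    by (rule verma_universal [OF t tensor_rep_is_uq_rep [OF t verma_is_uq_rep [OF t] rep]
          E_singular_vec singular_vec_weight])
  then have "is_Phi t \<mu> R w0 (Phi t \<mu> R w0)"
    unfolding Phi_def by (rule theI')
  then have \<Phi>: "intertwiner (verma t \<mu>) (T \<mu>) (Phi t \<mu> R w0)" "Phi t \<mu> R w0 (single 0 1) = singular_vec"
    by (auto simp: is_Phi_iff)
  show ?thesis
  proof (induction n)
    case (Suc n)
    have "Phi t \<mu> R w0 (single (Suc n) 1) = Phi t \<mu> R w0 (opF (verma t \<mu>) (single n 1))" by simp
    also have "\<dots> = opF (T \<mu>) (Phi t \<mu> R w0 (single n 1))"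
      using \<Phi>(1) by (simp only: intertwiner_def)
    finally show ?case using Suc by simp
  qed (simp add: \<Phi>)
qed

text \<open>
  Only the summand \<open>F\<^sup>k v\<^sub>\<mu> \<otimes> E\<^sup>k w\<^sub>0\<close> with the term \<open>(q\<^sup>-\<^sup>h \<otimes> F)\<^sup>k\<close> of \<open>\<Delta>(F)\<^sup>n\<close> leads back to
  \<open>F\<^sup>n v\<^sub>\<mu>\<close> in the first factor, and there \<open>F\<^sup>k E\<^sup>k w\<^sub>0\<close> is a multiple of \<open>w\<^sub>0\<close>.
\<close>

lemma lookup_Phi_diagonal:
  "lookup (Phi t \<mu> R w0 (single n 1)) (n, b) =
     (\<Sum>k\<le>m. qbin (qpow t 2) n k * (qpow t (- (of_nat k * (\<mu> - 2 * of_nat k))) * singular_coeff k *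
        (\<Prod>j<k. qnum t (of_nat m - of_nat j) * qnum t (of_nat (m + j + 1)))) * lookup w0 b)"
  unfolding Phi_single singular_vec_def clinear_rules(6) [OF clinear_funpow [OF clinear_tensor_rep(2)]]
    lookup_sum lookup_F_power
  by (intro sum.cong refl)
     (simp add: clinear_rules [OF clinear_funpow [OF clinear_ops(2)]] F_power_E_power [OF w0] mult.assoc)

text \<open>
  The weight factor \<open>q\<^bsup>- k (\<mu> - 2 k)\<^esup>\<close> supplies one \<open>q\<^sup>-\<^sup>\<mu>\<close> for each \<open>[\<mu> - i]\<close> in the denominator of
  the singular vector, which makes the coefficient rational in \<open>q\<^sup>2\<^sup>\<mu>\<close>.
\<close>

lemma singular_coeff_trace_coeff:
  "qpow t (- (of_nat k * (\<mu> - 2 * of_nat k))) * singular_coeff k *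
     (\<Prod>j<k. qnum t (of_nat m - of_nat j) * qnum t (of_nat (m + j + 1))) =
   trace_coeff t m k / (\<Prod>i<k. qpow t (- of_nat i) * qpow t (2 * \<mu>) - qpow t (of_nat i))"
proof (induction k)
  case (Suc k)
  define D where "D = qnum t (\<mu> - of_nat k)"
  have D: "D \<noteq> 0" using generic by (simp add: generic_def D_def)
  have *: "qpow t (- of_nat k) * qpow t (2 * \<mu>) - qpow t (of_nat k) = qpow t \<mu> * (d * D)"
  proof -
    have dD: "d * D = qpow t (\<mu> - of_nat k) - qpow t (- (\<mu> - of_nat k))"
      using d_nz by (simp add: D_def qnum_def)
    show ?thesis unfolding dD by (simp add: algebra_simps flip: qpow_add)
  qed
  define u where "u = qpow t (- (of_nat (Suc k) * (\<mu> - 2 * of_nat (Suc k))))"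
  define v where "v = qpow t (- 2 * (of_nat k + 1))"
  define M where "M = qpow t \<mu>"
  define U where "U = qpow t (- (of_nat k * (\<mu> - 2 * of_nat k)))"
  define P where "P = (\<Prod>j<k. qnum t (of_nat m - of_nat j) * qnum t (of_nat (m + j + 1)))"
  define p where "p = qnum t (of_nat m - of_nat k) * qnum t (of_nat (m + k + 1))"
  define Y where "Y = (\<Prod>i<k. qpow t (- of_nat i) * qpow t (2 * \<mu>) - qpow t (of_nat i))"
  define N where "N = qnum t (of_nat (Suc k))"
  have M: "M \<noteq> 0" by (simp add: M_def)
  have "u * (singular_coeff k * (- v / (N * D))) * (P * p) = (u * v) * (singular_coeff k * P) * (- p / (N * D))"
    by simp
  also have "u * v = qpow t (2 * of_nat k) * U / M"
    unfolding qpow_diff [symmetric] qpow_add [symmetric] u_def v_def U_def M_def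
    by (simp add: algebra_simps)
  also have "qpow t (2 * of_nat k) * U / M * (singular_coeff k * P) * (- p / (N * D)) =
      (U * singular_coeff k * P) * (- qpow t (2 * of_nat k) * p / (N * (M * D)))"
    by (simp add: mult_ac)
  also have "U * singular_coeff k * P = trace_coeff t m k / Y"
    using Suc by (simp add: U_def P_def Y_def)
  also have "trace_coeff t m k / Y * (- qpow t (2 * of_nat k) * p / (N * (M * D))) =
      trace_coeff t m k * (- qpow t (2 * of_nat k) * d * p / N) / (Y * (M * (d * D)))"
    using d_nz by simp
  finally show ?case
    unfolding u_def v_def M_def P_def p_def Y_def N_def D_def
    unfolding singular_coeff_def trace_coeff_def prod.lessThan_Suc
    using *  by (simp only: D_def)
qed (simp add: singular_coeff_def trace_coeff_def)

text \<open>
  Each Gaussian binomial coefficient contributes a generating function in \<open>q\<^sup>-\<^sup>2\<^sup>\<lambda>\<close> with poles at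
  \<open>q\<^sup>2\<^sup>\<lambda> = q\<^sup>2\<^sup>j\<close> for \<open>j \<le> m\<close>. All of them lie inside the excluded disc, whether the modulus
  of \<open>q\<close> is larger or smaller than \<open>1\<close>.
\<close>

lemma has_trace_Phi:
  assumes big: "norm (qpow t (2 * lam)) > 1 + norm (qpow t 2) ^ m"
  shows "has_trace t lam \<mu> (Phi t \<mu> R w0) (cscale (qpow t (lam * \<mu>) *
    (\<Sum>k\<le>m. trace_coeff t m k * (qpow t (2 * lam) / 
      ((\<Prod>j\<le>k. qpow t (2 * lam) - qpow t 2 ^ j) *
       (\<Prod>i<k. qpow t (- of_nat i) * qpow t (2 * \<mu>) - qpow t (of_nat i)))))) w0)"
  unfolding has_trace_def
proof
  fix b
  define X x Q where "X = qpow t (2 * lam)" and "x = inverse X" and "Q = qpow t 2"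
  have X: "X \<noteq> 0" by (simp add: X_def)
  have small: "norm (Q ^ j * x) < 1" if "j \<le> m" for j
  proof -
    have "norm Q ^ j \<le> 1 + norm Q ^ m"
    proof (cases "norm Q \<le> 1")
      case True
      then have "norm Q ^ j \<le> 1" by (intro power_le_one) auto
      then show ?thesis by (smt (verit) norm_ge_zero zero_le_power)
    next
      case False
      then have "norm Q ^ j \<le> norm Q ^ m" using that by (intro power_increasing) auto
      then show ?thesis by simp
    qed
    also have "\<dots> < norm X" using big by (simp add: X_def Q_def)
    finally show ?thesis using X 
      by (simp add: x_def norm_divide norm_power flip: divide_inverse)
  qed
  have xX: "x ^ k / (\<Prod>j\<le>k. 1 - Q ^ j * x) = X / (\<Prod>j\<le>k. X - Q ^ j)" for k
  proof -
    have "(\<Prod>j\<le>k. X - Q ^ j) = (\<Prod>j\<le>k. X * (1 - Q ^ j * x))"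
      using X by (intro prod.cong) (simp_all add: x_def field_simps)
    also have "\<dots> = X ^ Suc k * (\<Prod>j\<le>k. 1 - Q ^ j * x)" by (simp add: prod.distrib)
    finally show ?thesis using X by (simp add: x_def field_simps)
  qed
  define g where "g k = trace_coeff t m k / (\<Prod>i<k. qpow t (- of_nat i) * qpow t (2 * \<mu>) - qpow t (of_nat i))" for k
  have "(\<lambda>n. \<Sum>k\<le>m. (qpow t (lam * \<mu>) * g k * lookup w0 b) * (x ^ n * qbin Q n k)) sums
      (\<Sum>k\<le>m. (qpow t (lam * \<mu>) * g k * lookup w0 b) * (x ^ k / (\<Prod>j\<le>k. 1 - Q ^ j * x)))"
    by (intro sums_sum sums_mult qbin_sums small) auto
  moreover have "qpow t (lam * (\<mu> - 2 * of_nat n)) = qpow t (lam * \<mu>) * x ^ n" for n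
  proof -
    have "x ^ n = qpow t (of_nat n * (- (2 * lam)))"
      by (simp only: qpow_of_nat_mult) (simp add: x_def X_def qpow_minus)
    then show ?thesis by (simp add: algebra_simps flip: qpow_add)
  qed
  ultimately show "(\<lambda>n. qpow t (lam * (\<mu> - 2 * of_nat n)) * lookup (Phi t \<mu> R w0 (single n 1)) (n, b))
    sums lookup (cscale (qpow t (lam * \<mu>) *
    (\<Sum>k\<le>m. trace_coeff t m k * (qpow t (2 * lam) / 
      ((\<Prod>j\<le>k. qpow t (2 * lam) - qpow t 2 ^ j) *
       (\<Prod>i<k. qpow t (- of_nat i) * qpow t (2 * \<mu>) - qpow t (of_nat i)))))) w0) b"
    unfolding lookup_Phi_diagonal singular_coeff_trace_coeff xX X_def [symmetric] Q_def [symmetric]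
    by (simp add: sum_distrib_left sum_distrib_right g_def mult_ac)
qed

end
end

section \<open>Rational continuation\<close>

lemma poly2_simps [simp]:
  "poly2 (P + Q) x y = poly2 P x y + poly2 Q x y"
  "poly2 (P - Q) x y = poly2 P x y - poly2 Q x y"
  "poly2 (P * Q) x y = poly2 P x y * poly2 Q x y"
  "poly2 (sum f A) x y = (\<Sum>a\<in>A. poly2 (f a) x y)"
  "poly2 (prod f A) x y = (\<Prod>a\<in>A. poly2 (f a) x y)"
  "poly2 [:p:] x y = poly p y" "poly2 [:p, p':] x y = poly p y + x * poly p' y"
  by (simp_all add: poly2_def poly_sum poly_prod)

lemma poly2_eq_0I:
  assumes "infinite A" "\<And>x. x \<in> A \<Longrightarrow> infinite (B x)"
    and "\<And>x y. x \<in> A \<Longrightarrow> y \<in> B x \<Longrightarrow> poly2 P x y = 0"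
  shows "P = 0"
proof (rule ccontr)
  assume "P \<noteq> 0"
  then have fin: "finite {p. poly P p = 0}" by (rule poly_roots_finite)
  have "poly P [:x:] = 0" if "x \<in> A" for x
  proof (rule ccontr)
    assume "poly P [:x:] \<noteq> 0"
    then have "finite {y. poly (poly P [:x:]) y = 0}" by (rule poly_roots_finite)
    moreover have "B x \<subseteq> {y. poly (poly P [:x:]) y = 0}"
      using assms(3) [OF that] by (auto simp: poly2_def)
    ultimately show False using assms(2) [OF that] finite_subset by blast
  qed
  then have "(\<lambda>x. [:x:]) ` A \<subseteq> {p. poly P p = 0}" by auto
  then have "finite ((\<lambda>x. [:x:]) ` A)" using fin finite_subset by blast
  moreover have "inj_on (\<lambda>x. [:x:]) A" by (auto simp: inj_on_def)
  ultimately show False using assms(1) finite_imageD by blast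
qed

text \<open>
  The generic points needed for uniqueness of the continuation: infinitely many values of \<open>q\<^sup>2\<^sup>\<mu>\<close>
  come from negative integers \<open>\<mu>\<close>.
\<close>

lemma generic_negative:
  assumes "Re t \<noteq> 0"
  shows "generic t (- of_nat (Suc j))"
  unfolding generic_def
proof
  fix n
  have "- of_nat (Suc j) - of_nat n = (of_int (- int (Suc j + n)) :: complex)" by simp
  then show "qnum t (- of_nat (Suc j) - of_nat n) \<noteq> 0"
    using qnum_of_int_nz [OF assms, of "- int (Suc j + n)"] by (simp only:) simp
qed

lemma exists_qpow_eq:
  assumes "Re t \<noteq> 0" "x > 0"
  shows "\<exists>lam. qpow t (2 * lam) = of_real x"
proof
  have "t \<noteq> 0" using assms(1) by auto
  then have *: "t * (2 * (of_real (ln x) / (2 * t))) = of_real (ln x)" by simp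
  show "qpow t (2 * (of_real (ln x) / (2 * t))) = of_real x"
    unfolding qpow_def * using assms(2) by (simp add: exp_of_real)
qed

text \<open>
  Both fractions are the sum of the same series on a product of infinite sets of values of
  \<open>q\<^sup>2\<^sup>\<lambda>\<close> (large natural numbers) and \<open>q\<^sup>2\<^sup>\<mu>\<close> (powers of \<open>q\<^sup>-\<^sup>2\<close>), so they agree as
  fractions of polynomials.
\<close>

lemma continues_trace_unique:
  assumes t: "Re t \<noteq> 0" and w0: "w0 \<noteq> 0"
    and PQ: "continues_trace t V w0 P Q" and PQ': "continues_trace t V w0 P' Q'"
  shows "P * Q' = P' * Q"
proof -
  obtain b where b: "lookup w0 b \<noteq> 0"
    using w0 by (metis poly_mapping_eqI lookup_zero)
  obtain B where Q: "Q \<noteq> 0" and B: "\<And>lam \<mu>. generic t \<mu> \<Longrightarrow> cmod (qpow t (2 * lam)) > B \<Longrightarrow>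
        poly2 Q (qpow t (2 * lam)) (qpow t (2 * \<mu>)) \<noteq> 0 \<Longrightarrow>
        has_trace t lam \<mu> (Phi t \<mu> V w0) (cscale (qpow t (lam * \<mu>) *
          (poly2 P (qpow t (2 * lam)) (qpow t (2 * \<mu>)) / poly2 Q (qpow t (2 * lam)) (qpow t (2 * \<mu>)))) w0)"
    using PQ unfolding continues_trace_def by blast
  obtain B' where Q': "Q' \<noteq> 0" and B': "\<And>lam \<mu>. generic t \<mu> \<Longrightarrow> cmod (qpow t (2 * lam)) > B' \<Longrightarrow>
        poly2 Q' (qpow t (2 * lam)) (qpow t (2 * \<mu>)) \<noteq> 0 \<Longrightarrow>
        has_trace t lam \<mu> (Phi t \<mu> V w0) (cscale (qpow t (lam * \<mu>) *
          (poly2 P' (qpow t (2 * lam)) (qpow t (2 * \<mu>)) / poly2 Q' (qpow t (2 * lam)) (qpow t (2 * \<mu>)))) w0)"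
    using PQ' unfolding continues_trace_def by blast
  define A where "A = {x. \<exists>n. x = (of_nat n :: complex) \<and> real n > max 0 (max B B')}"
  define Y where "Y = range (\<lambda>j. qpow t (2 * (- of_nat (Suc j))))"
  have "infinite A"
  proof -
    obtain N where N: "real N > max 0 (max B B')" using reals_Archimedean2 by blast
    have "(of_nat :: nat \<Rightarrow> complex) ` {N..} \<subseteq> A"
    proof safe
      fix n assume "N \<le> n"
      then show "of_nat n \<in> A" using N unfolding A_def by (intro CollectI exI [of _ n]) simp
    qed
    moreover have "infinite ((of_nat :: nat \<Rightarrow> complex) ` {N..})"
      by (subst finite_image_iff) (auto simp: inj_on_def infinite_Ici)
    ultimately show ?thesis using finite_subset by blast
  qed
  moreover have "infinite Y"
    unfolding Y_def
  proof (rule range_inj_infinite, rule injI)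
    fix i j assume "qpow t (2 * (- of_nat (Suc i))) = qpow t (2 * (- of_nat (Suc j)))"
    then have "qpow t (of_real (- 2 * real (Suc i))) = qpow t (of_real (- 2 * real (Suc j)))" by simp
    then show "i = j" unfolding qpow_of_real_eq_iff [OF t] by simp
  qed
  \<comment> \<open>The factor \<open>Q * Q'\<close> makes the identity hold also where the fractions are undefined.\<close>
  moreover have "poly2 ((P * Q' - P' * Q) * (Q * Q')) x y = 0" if x: "x \<in> A" and y: "y \<in> Y" for x y
  proof (cases "poly2 Q x y = 0 \<or> poly2 Q' x y = 0")
    case False
    obtain n where n: "x = of_nat n" "real n > 0" "real n > B" "real n > B'"
      using x by (auto simp: A_def)
    obtain lam where lam: "qpow t (2 * lam) = x"
      using exists_qpow_eq [OF t, of "real n"] n by auto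
    obtain \<mu> where \<mu>: "qpow t (2 * \<mu>) = y" "generic t \<mu>"
      using y generic_negative [OF t] unfolding Y_def by blast
    have "has_trace t lam \<mu> (Phi t \<mu> V w0) (cscale (qpow t (lam * \<mu>) * (poly2 P x y / poly2 Q x y)) w0)"
      using B [OF \<mu>(2), of lam] False n by (simp add: lam \<mu>)
    moreover have "has_trace t lam \<mu> (Phi t \<mu> V w0) (cscale (qpow t (lam * \<mu>) * (poly2 P' x y / poly2 Q' x y)) w0)"
      using B' [OF \<mu>(2), of lam] False n by (simp add: lam \<mu>)
    ultimately have "lookup (cscale (qpow t (lam * \<mu>) * (poly2 P x y / poly2 Q x y)) w0) b =
        lookup (cscale (qpow t (lam * \<mu>) * (poly2 P' x y / poly2 Q' x y)) w0) b"
      unfolding has_trace_def by (blast intro: sums_unique2)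
    then have "poly2 P x y / poly2 Q x y = poly2 P' x y / poly2 Q' x y"
      using b by (simp del: times_divide_eq_left times_divide_eq_right)
    then show ?thesis using False by (simp add: field_simps)
  qed auto
  ultimately have "(P * Q' - P' * Q) * (Q * Q') = 0"
    by (intro poly2_eq_0I [of A "\<lambda>_. Y"]) auto
  then show ?thesis using Q Q' by simp
qed

text \<open>
  A point where \<open>\<Psi>\<close> is regular may still be a zero of the denominator of a given fraction, which
  need not be reduced. Hence the value is described with the denominator multiplied out.
\<close>

lemma Psi_mult_denominator:
  assumes t: "Re t \<noteq> 0" and w0: "w0 \<noteq> 0" and PQ: "continues_trace t V w0 P Q"
    and regular: "Psi_regular t V w0 lam \<mu>"
  shows "Psi t V w0 lam \<mu> * poly2 Q (qpow t (2 * lam)) (qpow t (2 * \<mu>)) =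
    qpow t (lam * \<mu>) * poly2 P (qpow t (2 * lam)) (qpow t (2 * \<mu>))"
proof -
  define x y where "x = qpow t (2 * lam)" and "y = qpow t (2 * \<mu>)"
  have cross: "poly2 P1 x y * poly2 Q2 x y = poly2 P2 x y * poly2 Q1 x y"
    if "continues_trace t V w0 P1 Q1" "continues_trace t V w0 P2 Q2" for P1 Q1 P2 Q2
    using continues_trace_unique [OF t w0 that] by (metis poly2_simps(3))
  obtain P' Q' where PQ': "continues_trace t V w0 P' Q'" "poly2 Q' x y \<noteq> 0"
    using regular by (auto simp: Psi_regular_def x_def y_def)
  have "Psi t V w0 lam \<mu> = qpow t (lam * \<mu>) * (poly2 P' x y / poly2 Q' x y)"
    unfolding Psi_def x_def [symmetric] y_def [symmetric]
  proof (rule the_equality)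
    fix z assume "\<exists>P Q. continues_trace t V w0 P Q \<and> poly2 Q x y \<noteq> 0 \<and>
      z = qpow t (lam * \<mu>) * (poly2 P x y / poly2 Q x y)"
    then show "z = qpow t (lam * \<mu>) * (poly2 P' x y / poly2 Q' x y)"
      using cross [OF _ PQ'(1)] PQ'(2) by (auto simp: frac_eq_eq)
  qed (use PQ' in blast)
  then have "Psi t V w0 lam \<mu> * poly2 Q x y = qpow t (lam * \<mu>) * (poly2 P' x y * poly2 Q x y) / poly2 Q' x y"
    by simp
  also have "\<dots> = qpow t (lam * \<mu>) * poly2 P x y"
    using cross [OF PQ PQ'(1)] PQ'(2) by (simp flip: cross [OF PQ PQ'(1)])
  finally show ?thesis by (simp add: x_def y_def)
qed

section \<open>The trace function as an explicit fraction\<close>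

abbreviation x_factor :: "complex \<Rightarrow> nat \<Rightarrow> complex poly poly" where
  "x_factor t j \<equiv> [:[:- (qpow t 2 ^ j):], 1:]"

abbreviation y_factor :: "complex \<Rightarrow> nat \<Rightarrow> complex poly poly" where
  "y_factor t i \<equiv> [:[:- qpow t (of_nat i), qpow t (- of_nat i):]:]"

definition trace_denom :: "complex \<Rightarrow> nat \<Rightarrow> complex poly poly" where
  "trace_denom t m = (\<Prod>j\<le>m. x_factor t j) * (\<Prod>i<m. y_factor t i)"

definition trace_numer :: "complex \<Rightarrow> nat \<Rightarrow> complex poly poly" where
  "trace_numer t m = (\<Sum>k\<le>m. [:0, [:trace_coeff t m k:]:] *
     (\<Prod>j\<in>{k<..m}. x_factor t j) * (\<Prod>i\<in>{k..<m}. y_factor t i))"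

lemma trace_denom_nz: "trace_denom t m \<noteq> 0"
  by (simp add: trace_denom_def)

lemma poly2_trace_denom:
  "poly2 (trace_denom t m) x y =
     (\<Prod>j\<le>m. x - qpow t 2 ^ j) * (\<Prod>i<m. qpow t (- of_nat i) * y - qpow t (of_nat i))"
  by (simp add: trace_denom_def algebra_simps)

lemma poly2_trace_numer:
  "poly2 (trace_numer t m) x y =
     (\<Sum>k\<le>m. trace_coeff t m k * x * (\<Prod>j\<in>{k<..m}. x - qpow t 2 ^ j) *
        (\<Prod>i\<in>{k..<m}. qpow t (- of_nat i) * y - qpow t (of_nat i)))"
  by (simp only: trace_numer_def poly2_simps) (simp add: algebra_simps)

lemma poly2_trace_fraction:
  assumes "poly2 (trace_denom t m) x y \<noteq> 0"
  shows "poly2 (trace_numer t m) x y / poly2 (trace_denom t m) x y =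
    (\<Sum>k\<le>m. trace_coeff t m k * (x / ((\<Prod>j\<le>k. x - qpow t 2 ^ j) *
       (\<Prod>i<k. qpow t (- of_nat i) * y - qpow t (of_nat i)))))"
  unfolding poly2_trace_numer sum_divide_distrib
proof (rule sum.cong [OF refl])
  fix k assume "k \<in> {..m}"
  then have k: "k \<le> m" by simp
  define f where "f j = x - qpow t 2 ^ j" for j
  define g where "g i = qpow t (- of_nat i) * y - qpow t (of_nat i)" for i
  have "prod f {..m} = prod f {..k} * prod f {k<..m}"
    using k by (subst prod.union_disjoint [symmetric]) (auto intro!: prod.cong)
  moreover have "prod g {..<m} = prod g {..<k} * prod g {k..<m}"
    using k by (subst prod.union_disjoint [symmetric]) (auto intro!: prod.cong)
  ultimately have den: "poly2 (trace_denom t m) x y =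
      (prod f {..k} * prod f {k<..m}) * (prod g {..<k} * prod g {k..<m})"
    by (simp only: poly2_trace_denom flip: f_def g_def)
  have nz: "prod f {..k} \<noteq> 0" "prod f {k<..m} \<noteq> 0" "prod g {..<k} \<noteq> 0" "prod g {k..<m} \<noteq> 0"
    using assms unfolding den mult_eq_0_iff by blast+
  have "trace_coeff t m k * x * prod f {k<..m} * prod g {k..<m} /
      ((prod f {..k} * prod f {k<..m}) * (prod g {..<k} * prod g {k..<m})) =
      trace_coeff t m k * (x / (prod f {..k} * prod g {..<k}))"
    using nz by (simp only: divide_simps mult_ac) simp
  then show "trace_coeff t m k * x * (\<Prod>j\<in>{k<..m}. x - qpow t 2 ^ j) *
      (\<Prod>i\<in>{k..<m}. qpow t (- of_nat i) * y - qpow t (of_nat i)) / poly2 (trace_denom t m) x y =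
      trace_coeff t m k * (x / ((\<Prod>j\<le>k. x - qpow t 2 ^ j) *
       (\<Prod>i<k. qpow t (- of_nat i) * y - qpow t (of_nat i))))"
    unfolding den by (simp only: flip: f_def g_def)
qed

lemma continues_trace_trace_fraction:
  assumes t: "Re t \<noteq> 0" and V: "irreducible_rep t V" "has_highest_weight t V (2 * of_nat m)"
    and w0: "w0 \<in> weight_space t V 0"
  shows "continues_trace t V w0 (trace_numer t m) (trace_denom t m)"
proof -
  interpret irreducible_module t V m
    using V by unfold_locales (auto simp: t irreducible_rep_def)
  show ?thesis
    unfolding continues_trace_def
  proof (intro conjI trace_denom_nz exI [of _ "1 + norm (qpow t 2) ^ m"] allI impI, elim conjE)
    fix lam \<mu>
    assume "generic t \<mu>" "1 + cmod (qpow t 2) ^ m < cmod (qpow t (2 * lam))"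
      and nz: "poly2 (trace_denom t m) (qpow t (2 * lam)) (qpow t (2 * \<mu>)) \<noteq> 0"
    then show "has_trace t lam \<mu> (Phi t \<mu> V w0)
      (cscale (qpow t (lam * \<mu>) *
         (poly2 (trace_numer t m) (qpow t (2 * lam)) (qpow t (2 * \<mu>)) /
          poly2 (trace_denom t m) (qpow t (2 * lam)) (qpow t (2 * \<mu>)))) w0)"
      unfolding poly2_trace_fraction [OF nz] by (intro has_trace_Phi w0)
  qed
qed

section \<open>Passing to the inverse of \<open>q\<close>\<close>

lemma trace_coeff_uminus:
  assumes t: "Re t \<noteq> 0" and k: "k \<le> m"
  shows "trace_coeff (- t) m k = qpow t (- (of_nat k * (of_nat k - 1))) *
    (qpow t 1 - qpow t (- 1)) ^ k * (qfact t (m + k) / (qfact t k * qfact t (m - k)))"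
  using k
proof (induction k)
  case 0
  show ?case using qfact_nz [OF t] by (simp add: trace_coeff_def qfact_def [of t 0])
next
  case (Suc k)
  define d where "d = qpow t 1 - qpow t (- 1)"
  have mk: "of_nat m - of_nat k = (of_nat (Suc (m - Suc k)) :: complex)"
    using Suc.prems by (simp flip: of_nat_Suc add: Suc_diff_Suc of_nat_diff)
  have "trace_coeff (- t) m (Suc k) = trace_coeff (- t) m k *
    (qpow t (- 2 * of_nat k) * d *
     (qnum t (of_nat (Suc (m - Suc k))) * qnum t (of_nat (Suc (m + k)))) / qnum t (of_nat (Suc k)))"
    unfolding trace_coeff_def prod.lessThan_Suc mk
    by (simp add: qnum_uminus_left qpow_uminus_left d_def minus_diff_eq [symmetric, of "qpow t 1"] del: of_nat_Suc minus_diff_eq)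
  also have "\<dots> = (qpow t (- (of_nat k * (of_nat k - 1))) * qpow t (- 2 * of_nat k)) * (d ^ k * d) *
    (qnum t (of_nat (Suc (m + k))) * qfact t (m + k) /
      ((qnum t (of_nat (Suc k)) * qfact t k) *
       (qfact t (m - k) / qnum t (of_nat (Suc (m - Suc k))))))"
    using Suc by (simp add: d_def mult_ac)
  also have "qpow t (- (of_nat k * (of_nat k - 1))) * qpow t (- 2 * of_nat k) =
      qpow t (- (of_nat (Suc k) * (of_nat (Suc k) - 1)))"
    by (simp add: algebra_simps flip: qpow_add)
  also have "qfact t (m - k) / qnum t (of_nat (Suc (m - Suc k))) = qfact t (m - Suc k)"
    using Suc.prems qnum_of_nat_nz [OF t, of "Suc (m - Suc k)"] qfact_Suc [of t "m - Suc k"]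
    by (simp add: Suc_diff_Suc del: of_nat_Suc)
  finally show ?case by (simp add: qfact_Suc d_def mult.commute del: of_nat_Suc)
qed

lemma prod_qpow_diff:
  "(\<Prod>j\<le>k. qpow t (lam - of_nat j)) =
     qpow t ((of_nat k + 1) * lam - of_nat k * (of_nat k + 1) / 2)"
proof (induction k)
  case (Suc k)
  then show ?case
    unfolding prod.atMost_Suc Suc qpow_add [symmetric]
    by (intro arg_cong [where f = "qpow t"]) (simp add: field_simps)
qed simp

text \<open>
  All powers of \<open>q\<close> that accompany the \<open>k\<close>-th summand, collected. The product of the
  \<open>q\<^sup>\<lambda>\<^sup>-\<^sup>j\<close> contributes a triangular number, which halves the exponent \<open>k (k - 1)\<close>.
\<close>

lemma summand_exponents:
  "qpow t (- (lam * (\<mu> + 1))) * qpow t (- (of_nat k * (of_nat k - 1))) * qpow t (2 * lam) /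
     ((\<Prod>j\<le>k. qpow t (lam - of_nat j)) * qpow t (\<mu> + 1) ^ k) =
   qpow t (- (lam * \<mu>)) * qpow t (- (of_nat k * (of_nat k - 1) / 2)) *
     qpow t (- (of_nat k * (lam + \<mu>)))"
  unfolding prod_qpow_diff qpow_of_nat_mult [symmetric] qpow_add [symmetric] qpow_diff [symmetric]
  by (intro arg_cong [where f = "qpow t"]) (simp add: field_simps)

theorem corollary7p2:
  fixes t :: complex and m :: nat
    and V :: "complex \<Rightarrow> 'b uq_rep" and w0 :: "complex \<Rightarrow> ('b \<Rightarrow>\<^sub>0 complex)"
    and lam \<mu> :: complex
  assumes t: "Re t \<noteq> 0"
    and V_irreducible: "\<And>s. Re s \<noteq> 0 \<Longrightarrow> irreducible_rep s (V s)"
    and V_highest: "\<And>s. Re s \<noteq> 0 \<Longrightarrow> has_highest_weight s (V s) (2 * of_nat m)"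
    and w0_zero_weight: "\<And>s. Re s \<noteq> 0 \<Longrightarrow> w0 s \<in> weight_space s (V s) 0"
    and w0_nonzero: "\<And>s. Re s \<noteq> 0 \<Longrightarrow> w0 s \<noteq> 0"
  shows "(delta_V t m (- lam - 1) \<noteq> 0 \<and> delta_V t m (- \<mu> - 1) \<noteq> 0 \<and> delta_q t lam \<noteq> 0 \<longrightarrow>
            Psi_regular (- t) (V (- t)) (w0 (- t)) (- lam) (- \<mu> - 1)) \<and>
         (Psi_regular (- t) (V (- t)) (w0 (- t)) (- lam) (- \<mu> - 1) \<longrightarrow>
            u_V t m V w0 lam \<mu> =
              qpow t (- (lam * \<mu>)) *
              (\<Sum>l=0..m. qpow t (- (of_nat l * (of_nat l - 1) / 2)) *
                 (qpow t 1 - qpow t (- 1)) ^ l *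
                 (qfact t (m + l) / (qfact t l * qfact t (m - l))) *
                 qpow t (- (of_nat l * (lam + \<mu>))) *
                 (\<Prod>j=l+1..m. (qpow t (lam + of_nat j) - qpow t (- lam - of_nat j)) *
                              (qpow t (\<mu> + of_nat j) - qpow t (- \<mu> - of_nat j)))))"
proof -
  have t': "Re (- t) \<noteq> 0" using t by simp
  note cont = continues_trace_trace_fraction [OF t' V_irreducible [OF t'] V_highest [OF t']
      w0_zero_weight [OF t']]
  define f where "f \<nu> j = qpow t (\<nu> + of_nat j) - qpow t (- \<nu> - of_nat j)" for \<nu> j
  define u where "u j = qpow t (lam - of_nat j)" for j
  define M where "M = qpow t (\<mu> + 1)"
  define x y where "x = qpow (- t) (2 * (- lam))" and "y = qpow (- t) (2 * (- \<mu> - 1))"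
  define \<delta> where "\<delta> = delta_V t m (- lam - 1) * delta_V t m (- \<mu> - 1) * delta_q t lam"
  have u_nz: "prod u A \<noteq> 0" for A
    by (cases "finite A") (auto simp: u_def)
  have M_nz: "M \<noteq> 0" by (simp add: M_def)
  have x_eq: "x - qpow (- t) 2 ^ j = u j * f lam j" for j
  proof -
    have "qpow (- t) 2 ^ j = qpow t (of_nat j * - 2)"
      by (simp only: qpow_of_nat_mult qpow_uminus_left)
    then show ?thesis
      by (simp add: x_def u_def f_def qpow_uminus_left algebra_simps flip: qpow_add)
  qed
  have y_eq: "qpow (- t) (- of_nat i) * y - qpow (- t) (of_nat i) = M * f \<mu> (Suc i)" for i
    by (simp add: y_def M_def f_def qpow_uminus_left algebra_simps flip: qpow_add)
  have delta: "delta_V t m (- \<nu> - 1) = (- 1) ^ m * (\<Prod>j=1..m. f \<nu> j)" for \<nu>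
  proof -
    have "delta_V t m (- \<nu> - 1) = (\<Prod>j=1..m. - 1 * f \<nu> j)"
      unfolding delta_V_def by (intro prod.cong) (simp_all add: f_def algebra_simps)
    then show ?thesis unfolding prod.distrib by simp
  qed
  have "\<delta> = ((- 1) ^ m * (- 1) ^ m) * (f lam 0 * (\<Prod>j=1..m. f lam j)) * (\<Prod>j=1..m. f \<mu> j)"
    unfolding \<delta>_def delta by (simp add: delta_q_def f_def)
  also have "f lam 0 * (\<Prod>j=1..m. f lam j) = (\<Prod>j\<le>m. f lam j)"
    by (simp add: prod.atMost_shift prod.atLeast1_atMost_eq)
  finally have \<delta>: "\<delta> = (\<Prod>j\<le>m. f lam j) * (\<Prod>j<m. f \<mu> (Suc j))"
    by (simp add: prod.atLeast1_atMost_eq flip: power_mult_distrib)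
  \<comment> \<open>Up to a unit, the three \<open>\<delta>\<close> factors are the denominator of the trace function. The units
    \<open>prod u {..m}\<close> and \<open>M ^ m\<close> also occur in the numerator and will cancel.\<close>
  have denom: "poly2 (trace_denom (- t) m) x y = prod u {..m} * M ^ m * \<delta>"
    unfolding poly2_trace_denom x_eq y_eq prod.distrib \<delta> by simp
  have numer: "poly2 (trace_numer (- t) m) x y = prod u {..m} * M ^ m *
      (\<Sum>l\<le>m. trace_coeff (- t) m l * x / (prod u {..l} * M ^ l) * (\<Prod>j=l+1..m. f lam j * f \<mu> j))"
    unfolding poly2_trace_numer sum_distrib_left
  proof (rule sum.cong [OF refl])
    fix l assume "l \<in> {..m}"
    then have l: "l \<le> m" by simp
    have "prod u {..m} = prod u {..l} * prod u {l<..m}"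
      using l by (subst prod.union_disjoint [symmetric]) (auto intro!: prod.cong)
    moreover have "M ^ m = M ^ l * M ^ (m - l)"
      using l by (simp flip: power_add)
    moreover have "(\<Prod>i\<in>{l..<m}. f \<mu> (Suc i)) = (\<Prod>j\<in>{l<..m}. f \<mu> j)"
      by (simp only: prod.shift_bounds_Suc_ivl [symmetric] atLeastLessThanSuc_atLeastAtMost
          atLeastSucAtMost_greaterThanAtMost)
    moreover have "{l + 1..m} = {l<..m}" by auto
    ultimately show "trace_coeff (- t) m l * x * (\<Prod>j\<in>{l<..m}. x - qpow (- t) 2 ^ j) *
        (\<Prod>i\<in>{l..<m}. qpow (- t) (- of_nat i) * y - qpow (- t) (of_nat i)) =
        prod u {..m} * M ^ m *
        (trace_coeff (- t) m l * x / (prod u {..l} * M ^ l) * (\<Prod>j=l+1..m. f lam j * f \<mu> j))"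
      unfolding x_eq y_eq using u_nz [of "{..l}"] M_nz by (simp add: prod.distrib)
  qed
  show ?thesis
  proof (intro conjI impI)
    assume "delta_V t m (- lam - 1) \<noteq> 0 \<and> delta_V t m (- \<mu> - 1) \<noteq> 0 \<and> delta_q t lam \<noteq> 0"
    then have "poly2 (trace_denom (- t) m) x y \<noteq> 0"
      unfolding denom \<delta>_def using u_nz [of "{..m}"] M_nz by simp
    then show "Psi_regular (- t) (V (- t)) (w0 (- t)) (- lam) (- \<mu> - 1)"
      unfolding Psi_regular_def x_def y_def using cont by blast
  next
    assume regular: "Psi_regular (- t) (V (- t)) (w0 (- t)) (- lam) (- \<mu> - 1)"
    define \<Psi> where "\<Psi> = Psi (- t) (V (- t)) (w0 (- t)) (- lam) (- \<mu> - 1)"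
    define S where "S = (\<Sum>l\<le>m. trace_coeff (- t) m l * x / (prod u {..l} * M ^ l) *
      (\<Prod>j=l+1..m. f lam j * f \<mu> j))"
    have "\<Psi> * (prod u {..m} * M ^ m * \<delta>) =
        qpow (- t) (- lam * (- \<mu> - 1)) * (prod u {..m} * M ^ m * S)"
      using Psi_mult_denominator [OF t' w0_nonzero [OF t'] cont regular]
      unfolding \<Psi>_def x_def [symmetric] y_def [symmetric] denom numer S_def .
    then have "(prod u {..m} * M ^ m) * (\<delta> * \<Psi>) =
        (prod u {..m} * M ^ m) * (qpow (- t) (- lam * (- \<mu> - 1)) * S)"
      by (simp only: mult_ac)
    then have "\<delta> * \<Psi> = qpow (- t) (- lam * (- \<mu> - 1)) * S"
      using u_nz [of "{..m}"] M_nz by simp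
    also have "qpow (- t) (- lam * (- \<mu> - 1)) = qpow t (- (lam * (\<mu> + 1)))"
      by (simp add: qpow_uminus_left algebra_simps)
    also have "qpow t (- (lam * (\<mu> + 1))) * S = qpow t (- (lam * \<mu>)) *
      (\<Sum>l\<le>m. qpow t (- (of_nat l * (of_nat l - 1) / 2)) * (qpow t 1 - qpow t (- 1)) ^ l *
         (qfact t (m + l) / (qfact t l * qfact t (m - l))) * qpow t (- (of_nat l * (lam + \<mu>))) *
         (\<Prod>j=l+1..m. f lam j * f \<mu> j))"
      unfolding S_def sum_distrib_left
    proof (rule sum.cong [OF refl])
      fix l assume "l \<in> {..m}"
      then have l: "l \<le> m" by simp
      define D G where "D = (qpow t 1 - qpow t (- 1)) ^ l"
        and "G = qfact t (m + l) / (qfact t l * qfact t (m - l))"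
      have x: "x = qpow t (2 * lam)" by (simp add: x_def qpow_uminus_left)
      have "qpow t (- (lam * (\<mu> + 1))) *
          (qpow t (- (of_nat l * (of_nat l - 1))) * D * G * x / (prod u {..l} * M ^ l) *
            (\<Prod>j=l+1..m. f lam j * f \<mu> j)) =
          qpow t (- (lam * (\<mu> + 1))) * qpow t (- (of_nat l * (of_nat l - 1))) * x / (prod u {..l} * M ^ l) *
            (D * G * (\<Prod>j=l+1..m. f lam j * f \<mu> j))"
        by simp
      also have "\<dots> = qpow t (- (lam * \<mu>)) * qpow t (- (of_nat l * (of_nat l - 1) / 2)) *
          qpow t (- (of_nat l * (lam + \<mu>))) * (D * G * (\<Prod>j=l+1..m. f lam j * f \<mu> j))"
        unfolding x u_def M_def summand_exponents ..
      finally show "qpow t (- (lam * (\<mu> + 1))) * (trace_coeff (- t) m l * x / (prod u {..l} * M ^ l) *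
          (\<Prod>j=l+1..m. f lam j * f \<mu> j)) = qpow t (- (lam * \<mu>)) *
        (qpow t (- (of_nat l * (of_nat l - 1) / 2)) * (qpow t 1 - qpow t (- 1)) ^ l *
         (qfact t (m + l) / (qfact t l * qfact t (m - l))) * qpow t (- (of_nat l * (lam + \<mu>))) *
         (\<Prod>j=l+1..m. f lam j * f \<mu> j))"
        unfolding trace_coeff_uminus [OF t l] D_def [symmetric] G_def [symmetric]
        by (simp only: mult_ac)
    qed
    finally show "u_V t m V w0 lam \<mu> =
              qpow t (- (lam * \<mu>)) *
              (\<Sum>l=0..m. qpow t (- (of_nat l * (of_nat l - 1) / 2)) *
                 (qpow t 1 - qpow t (- 1)) ^ l *
                 (qfact t (m + l) / (qfact t l * qfact t (m - l))) *
                 qpow t (- (of_nat l * (lam + \<mu>))) *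
                 (\<Prod>j=l+1..m. (qpow t (lam + of_nat j) - qpow t (- lam - of_nat j)) *
                              (qpow t (\<mu> + of_nat j) - qpow t (- \<mu> - of_nat j))))"
      by (simp only: u_V_def \<delta>_def \<Psi>_def f_def atMost_atLeast0)
  qed
qed

end
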